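(* Let $d\ge2$, $\nu\ge0$, $\sigma_1,\sigma_2\in\mathbb{R}$ with $\sigma_1\ne0$, $\rho_0\in L^1\cap L^\infty(\mathbb{R}^d)$, $T>0$, and let $\rho^\nu$ be a weak solution to $(GAG_\nu)$ on $[0,T]$ with initial density $\rho_0$. Assume that there are constants $C,R_0>0$ and some $N>d+1$ such that $\|b_R\rho_0\|^2\le CR^{-N}$ for all $R\ge R_0$. Then for all $t\in[0,T]$, $$m(\rho^\nu(t))=m(\rho_0)+(\sigma_1+\sigma_2)\int_0^t\|\rho^\nu(s)\|^2\,ds.$$
   Context: $\|\cdot\|$ without subscript denotes the $L^2(\mathbb{R}^d)$ norm; for $f\in L^1(\mathbb{R}^d)$, $m(f)=\int_{\mathbb{R}^d}f$. Let $a\in C^\infty(\mathbb{R}^d)$ be a fixed radially symmetric function supported in $B_2(0)$ with $a\equiv1$ on $B_1(0)$ and $a(x)$ nonincreasing in $|x|$; set $a_R(x)=a(x/R)$ and $b_R=1-a_R$. $\Phi$ is the fundamental solution of the Laplacian on $\mathbb{R}^d$ ($\Delta\Phi=\delta$). For $\nu\ge 0$ and real constants $\sigma_1\ne0$, $\sigma_2$, $(GAG_\nu)$ is the system on $\mathbb{R}^d$: $\partial_t\rho^\nu+\mathbf v^\nu\cdot\nabla\rho^\nu=\sigma_2(\rho^\nu)^2+\nu\Delta\rho^\nu$, $\ \mathbf v^\nu=\sigma_1\nabla\Phi*\rho^\nu$, $\ \rho^\nu(0)=\rho_0$; thus $\operatorname{div}\mathbf v^\nu=\sigma_1\rho^\nu$.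 Weak solution: for $\nu\ge0$ and $\rho_0\in L^1\cap L^\infty$, $\rho^\nu$ is a weak solution to $(GAG_\nu)$ on $[0,T]$ with initial density $\rho_0$ if $\rho^\nu(0)=\rho_0$ (i.e. $\rho^\nu(t)\to\rho_0$ in $L^2$ as $t\to0^+$), $\rho^\nu\in L^\infty(0,T;L^1\cap L^\infty)\cap C([0,T];L^2)$, $\partial_t\rho^\nu\in L^2(0,T;H^{-1})$, $\rho^\nu\in L^2(0,T;H^1)$ if $\nu>0$, and, with $\mathbf v^\nu=\sigma_1\nabla\Phi*\rho^\nu$, for all $\varphi\in C_c^\infty([0,T)\times\mathbb{R}^d)$, $$\int_0^T\!\!\int_{\mathbb{R}^d}\left(\rho^\nu\partial_t\varphi+\rho^\nu\mathbf v^\nu\cdot\nabla\varphi+(\sigma_1+\sigma_2)(\rho^\nu)^2\varphi-\nu\nabla\rho^\nu\cdot\nabla\varphi\right)dx\,dt=-\int_{\mathbb{R}^d}\rho_0\,\varphi(0,\cdot)\,dx$$ (the last term in the left integrand is absent when $\nu=0$). *)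

theory Defs
  imports "HOL-Analysis.Analysis"
begin

text \<open>
  Euclidean space R^d is a type of class \<^class>\<open>euclidean_space\<close> with d = DIM('a).  All measure theory
  is with respect to Lebesgue measure, and elements of the function spaces are represented by
  functions; no notion below depends on the choice of a representative modulo null sets.
\<close>

section \<open>Smooth functions and test functions\<close>

primrec Ck :: "nat \<Rightarrow> ('a::euclidean_space \<Rightarrow> real) \<Rightarrow> bool" where
  "Ck 0 f \<longleftrightarrow> continuous_on UNIV f"
| "Ck (Suc k) f \<longleftrightarrow> f differentiable_on UNIV \<and>
     (\<forall>b\<in>Basis. Ck k (\<lambda>x. frechet_derivative f (at x) b))"

definition smooth :: "('a::euclidean_space \<Rightarrow> real) \<Rightarrow> bool" where
  "smooth f \<longleftrightarrow> (\<forall>k. Ck k f)"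

definition test_function :: "'a::euclidean_space set \<Rightarrow> ('a \<Rightarrow> real) \<Rightarrow> bool" where
  "test_function U f \<longleftrightarrow> smooth f \<and> (\<exists>K. compact K \<and> K \<subseteq> U \<and> (\<forall>x. x \<notin> K \<longrightarrow> f x = 0))"

text \<open>
  Space-time test functions on [0,T) x R^d: functions smooth up to t = 0, i.e. restrictions to
  t >= 0 of smooth functions on the whole of R x R^d; only the restriction has to be compactly
  supported.
\<close>

definition spacetime_test_function :: "real \<Rightarrow> (real \<times> 'a::euclidean_space \<Rightarrow> real) \<Rightarrow> bool" where
  "spacetime_test_function T \<phi> \<longleftrightarrow> smooth \<phi> \<and>
     (\<exists>K. compact K \<and> K \<subseteq> {0..<T} \<times> UNIV \<and> (\<forall>t x. 0 \<le> t \<longrightarrow> (t, x) \<notin> K \<longrightarrow> \<phi> (t, x) = 0))"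

definition grad :: "('a::euclidean_space \<Rightarrow> real) \<Rightarrow> 'a \<Rightarrow> 'a" where
  "grad f x = (THE D. GDERIV f x :> D)"

section \<open>Function spaces on R^d\<close>

definition L1_norm :: "('a::euclidean_space \<Rightarrow> real) \<Rightarrow> real" where
  "L1_norm f = (LINT x|lebesgue. \<bar>f x\<bar>)"

definition mass :: "('a::euclidean_space \<Rightarrow> real) \<Rightarrow> real" where
  "mass f = (LINT x|lebesgue. f x)"

definition in_L1_Linf :: "('a::euclidean_space \<Rightarrow> real) \<Rightarrow> bool" where
  "in_L1_Linf f \<longleftrightarrow> integrable lebesgue f \<and> (\<exists>K. AE x in lebesgue. \<bar>f x\<bar> \<le> K)"

definition in_L2 :: "('a::euclidean_space \<Rightarrow> 'b::euclidean_space) \<Rightarrow> bool" where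
  "in_L2 f \<longleftrightarrow> f \<in> borel_measurable lebesgue \<and> integrable lebesgue (\<lambda>x. (norm (f x))\<^sup>2)"

definition L2_norm :: "('a::euclidean_space \<Rightarrow> 'b::euclidean_space) \<Rightarrow> real" where
  "L2_norm f = sqrt (LINT x|lebesgue. (norm (f x))\<^sup>2)"

definition locally_integrable :: "('a::euclidean_space \<Rightarrow> 'b::euclidean_space) \<Rightarrow> bool" where
  "locally_integrable f \<longleftrightarrow> (\<forall>K. compact K \<longrightarrow> set_integrable lebesgue K f)"

definition has_weak_gradient :: "('a::euclidean_space \<Rightarrow> real) \<Rightarrow> ('a \<Rightarrow> 'a) \<Rightarrow> bool" where
  "has_weak_gradient u g \<longleftrightarrow> locally_integrable u \<and> locally_integrable g \<and>
     (\<forall>\<psi> b. test_function UNIV \<psi> \<longrightarrow> b \<in> Basis \<longrightarrow>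
        (LINT x|lebesgue. u x * frechet_derivative \<psi> (at x) b) = - (LINT x|lebesgue. (g x \<bullet> b) * \<psi> x))"

text \<open>The weak gradient is unique up to null sets, so the choice is immaterial.\<close>

definition weak_grad :: "('a::euclidean_space \<Rightarrow> real) \<Rightarrow> 'a \<Rightarrow> 'a" where
  "weak_grad u = (SOME g. has_weak_gradient u g)"

definition in_H1 :: "('a::euclidean_space \<Rightarrow> real) \<Rightarrow> bool" where
  "in_H1 u \<longleftrightarrow> in_L2 u \<and> (\<exists>g. has_weak_gradient u g) \<and> in_L2 (weak_grad u)"

text \<open>The norms of H^1 and of its dual H^{-1} take the value \<open>\<infinity>\<close> exactly off the space.\<close>

definition H1_norm :: "('a::euclidean_space \<Rightarrow> real) \<Rightarrow> ennreal" where
  "H1_norm u = (if in_H1 u then ennreal (sqrt ((L2_norm u)\<^sup>2 + (L2_norm (weak_grad u))\<^sup>2)) else \<infinity>)"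

text \<open>An element of H^{-1} is a functional whose values off H^1 are irrelevant.\<close>

definition linear_on_H1 :: "(('a::euclidean_space \<Rightarrow> real) \<Rightarrow> real) \<Rightarrow> bool" where
  "linear_on_H1 G \<longleftrightarrow>
     (\<forall>u w. in_H1 u \<longrightarrow> in_H1 w \<longrightarrow> G (\<lambda>x. u x + w x) = G u + G w) \<and>
     (\<forall>c u. in_H1 u \<longrightarrow> G (\<lambda>x. c * u x) = c * G u)"

definition Hm1_norm :: "(('a::euclidean_space \<Rightarrow> real) \<Rightarrow> real) \<Rightarrow> ennreal" where
  "Hm1_norm G = (if linear_on_H1 G then (SUP u\<in>{u. H1_norm u \<le> 1}. ennreal \<bar>G u\<bar>) else \<infinity>)"

section \<open>Functions of time with values in a function space\<close>

text \<open>
  The Bochner space L^2(0,T;X), where X is the space of all \<open>v\<close> with \<open>N v < \<infinity>\<close>.  Strong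
  measurability is almost everywhere approximability by X-valued simple functions.
\<close>

definition in_L2_time :: "real \<Rightarrow> (('b \<Rightarrow> real) \<Rightarrow> ennreal) \<Rightarrow> (real \<Rightarrow> 'b \<Rightarrow> real) \<Rightarrow> bool" where
  "in_L2_time T N f \<longleftrightarrow>
     (\<exists>s. (\<forall>n::nat. simple_function (lebesgue_on {0..T}) (s n) \<and> (\<forall>t\<in>{0..T}. N (s n t) < \<infinity>)) \<and>
          (AE t in lebesgue_on {0..T}. (\<lambda>n. N (\<lambda>x. s n t x - f t x)) \<longlonglongrightarrow> 0)) \<and>
     (\<integral>\<^sup>+t. (N (f t))\<^sup>2 \<partial>lebesgue_on {0..T}) < \<infinity>"

definition continuous_L2 :: "real \<Rightarrow> (real \<Rightarrow> 'a::euclidean_space \<Rightarrow> real) \<Rightarrow> bool" where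
  "continuous_L2 T f \<longleftrightarrow> (\<forall>t\<in>{0..T}. in_L2 (f t) \<and>
     ((\<lambda>s. L2_norm (\<lambda>x. f s x - f t x)) \<longlongrightarrow> 0) (at t within {0..T}))"

text \<open>
  The uniform bounds of L^\<open>\<infinity>\<close>(0,T; L^1 \<open>\<inter>\<close> L^\<open>\<infinity>\<close>).  As usual for L^\<open>\<infinity>\<close>-valued functions, strong
  measurability is not part of the notion; measurability in time is supplied by
  \<^const>\<open>continuous_L2\<close>, with which this is always combined.
\<close>

definition bounded_L1_Linf :: "real \<Rightarrow> (real \<Rightarrow> 'a::euclidean_space \<Rightarrow> real) \<Rightarrow> bool" where
  "bounded_L1_Linf T f \<longleftrightarrow> (\<exists>K. AE t in lebesgue_on {0..T}.
     integrable lebesgue (f t) \<and> L1_norm (f t) \<le> K \<and> (AE x in lebesgue. \<bar>f t x\<bar> \<le> K))"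

text \<open>
  \<open>G\<close> is the distributional derivative in time of \<open>f\<close>, with L^2 embedded in H^{-1} by the L^2
  pairing; the identity in H^{-1} is evaluated at an arbitrary \<open>\<psi>\<close> in H^1.
\<close>

definition has_weak_time_derivative ::
    "real \<Rightarrow> (real \<Rightarrow> 'a::euclidean_space \<Rightarrow> real) \<Rightarrow> (real \<Rightarrow> ('a \<Rightarrow> real) \<Rightarrow> real) \<Rightarrow> bool" where
  "has_weak_time_derivative T f G \<longleftrightarrow>
     (\<forall>\<theta> \<psi>. test_function {0<..<T} \<theta> \<longrightarrow> in_H1 \<psi> \<longrightarrow>
        (LINT t:{0..T}|lebesgue. deriv \<theta> t * (LINT x|lebesgue. f t x * \<psi> x))
        = - (LINT t:{0..T}|lebesgue. \<theta> t * G t \<psi>))"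

section \<open>The aggregation equations\<close>

text \<open>
  The fundamental solution with the sign convention \<open>\<Delta> \<Phi> = \<delta>\<close>, for d >= 2.
\<close>

definition fundamental_solution :: "'a::euclidean_space \<Rightarrow> real" where
  "fundamental_solution x =
     (let d = DIM('a) in
      if d = 2 then ln (norm x) / (2 * pi)
      else - 1 / (real d * (real d - 2) * unit_ball_vol (real d) * norm x ^ (d - 2)))"

definition velocity :: "real \<Rightarrow> ('a::euclidean_space \<Rightarrow> real) \<Rightarrow> 'a \<Rightarrow> 'a" where
  "velocity \<sigma>\<^sub>1 f x = \<sigma>\<^sub>1 *\<^sub>R (LINT y|lebesgue. f y *\<^sub>R grad fundamental_solution (x - y))"

text \<open>
  The space-time integrals are iterated integrals: a continuous curve in L^2 determines each
  \<open>\<rho> t\<close> only up to a null set depending on \<open>t\<close>, so joint measurability of the chosen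
  representatives is not required.
\<close>

definition weak_solution_GAG ::
    "real \<Rightarrow> real \<Rightarrow> real \<Rightarrow> real \<Rightarrow> ('a::euclidean_space \<Rightarrow> real) \<Rightarrow> (real \<Rightarrow> 'a \<Rightarrow> real) \<Rightarrow> bool" where
  "weak_solution_GAG \<nu> \<sigma>\<^sub>1 \<sigma>\<^sub>2 T \<rho>\<^sub>0 \<rho> \<longleftrightarrow>
     ((\<lambda>t. L2_norm (\<lambda>x. \<rho> t x - \<rho>\<^sub>0 x)) \<longlongrightarrow> 0) (at_right 0) \<and>
     bounded_L1_Linf T \<rho> \<and>
     continuous_L2 T \<rho> \<and>
     (\<exists>G. in_L2_time T Hm1_norm G \<and> has_weak_time_derivative T \<rho> G) \<and>
     (\<nu> > 0 \<longrightarrow> in_L2_time T H1_norm \<rho>) \<and>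
     (\<forall>\<phi>. spacetime_test_function T \<phi> \<longrightarrow>
        (LINT t:{0..T}|lebesgue. LINT x|lebesgue.
            \<rho> t x * deriv (\<lambda>s. \<phi> (s, x)) t
            + \<rho> t x * (velocity \<sigma>\<^sub>1 (\<rho> t) x \<bullet> grad (\<lambda>y. \<phi> (t, y)) x)
            + (\<sigma>\<^sub>1 + \<sigma>\<^sub>2) * (\<rho> t x)\<^sup>2 * \<phi> (t, x)
            - \<nu> * (weak_grad (\<rho> t) x \<bullet> grad (\<lambda>y. \<phi> (t, y)) x))
        = - (LINT x|lebesgue. \<rho>\<^sub>0 x * \<phi> (0, x)))"

section \<open>Cutoff functions\<close>

definition cutoff :: "('a::euclidean_space \<Rightarrow> real) \<Rightarrow> bool" where
  "cutoff a \<longleftrightarrow> smooth a \<and>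
     (\<forall>x y. norm x = norm y \<longrightarrow> a x = a y) \<and>
     (\<forall>x. x \<notin> ball 0 2 \<longrightarrow> a x = 0) \<and>
     (\<forall>x\<in>ball 0 1. a x = 1) \<and>
     (\<forall>x y. norm x \<le> norm y \<longrightarrow> a y \<le> a x)"

definition outer_cutoff :: "('a::euclidean_space \<Rightarrow> real) \<Rightarrow> real \<Rightarrow> 'a \<Rightarrow> real" where
  "outer_cutoff a R x = 1 - a (x /\<^sub>R R)"

end

theory Submission
  imports Defs
begin

text \<open>
  Test the equation with \<open>\<theta>(t) a(x / R)\<close>.  For fixed \<open>R\<close> the localized mass \<open>\<integral> \<rho>(t) a\<^sub>R\<close> is continuous in
  time, so letting \<open>\<theta>\<close> approach the indicator of \<open>[0,t]\<close> shows that its increment is the time integral of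
  \<open>\<integral> \<rho> v \<bullet> \<nabla>a\<^sub>R + (\<sigma>\<^sub>1 + \<sigma>\<^sub>2) \<integral> \<rho>\<^sup>2 a\<^sub>R + \<nu> \<integral> \<rho> \<Delta>a\<^sub>R\<close>.  The kernel \<open>\<nabla>\<Phi>\<close> is of order
  \<open>\<bar>x\<bar>\<^sup>1\<^sup>-\<^sup>d\<close>, so \<open>v\<close> is bounded in terms of the \<open>L\<^sup>1\<close> and \<open>L\<^sup>\<infinity>\<close> norms of \<open>\<rho>\<close>, and the first and
  last terms are \<open>O(R\<^sup>-\<^sup>1)\<close> and \<open>O(R\<^sup>-\<^sup>2)\<close>.  Dominated convergence as \<open>R \<rightarrow> \<infinity>\<close> gives the identity at every
  time, since \<open>\<rho>(t)\<close> is integrable for every \<open>t\<close> as an \<open>L\<^sup>2\<close> limit of densities bounded in \<open>L\<^sup>1\<close>.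
\<close>

section \<open>Smooth functions\<close>

text \<open>The obstacle is measurability in time. Each \<open>\<rho> t\<close> is fixed only up to
  a null set, so no jointly measurable density is at hand and no Fubini argument over space-time;
  every quantity integrated in time has to be measurable as a scalar function of time. Linear and
  bilinear functionals bounded in L2 are continuous along the curve, which settles the mass, the
  quadratic term and the diffusion. The flux is different: the singularity of the Newton kernel at
  the origin is not square-integrable, so a direct Cauchy-Schwarz bound fails. It is therefore
  obtained as an almost everywhere limit of fluxes with truncated kernels, which are continuous in
  time. For the diffusion both derivatives are moved to the cutoff, so weak gradients only have to
  exist at almost every time. The given cutoff also provides the step functions in time: restricted
  to a ray, its profile descends from 1 to 0.\<close>

lemma Ck_SucI:
  assumes "\<And>x. (f has_derivative D x) (at x)" and "\<And>b. b \<in> Basis \<Longrightarrow> Ck k (\<lambda>x. D x b)"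
  shows "Ck (Suc k) f"
proof -
  have "frechet_derivative f (at x) = D x" for x
    using frechet_derivative_at[OF assms(1)] by simp
  with assms show ?thesis
    by (auto simp: differentiable_on_def differentiable_def intro: has_derivative_at_withinI)
qed

lemma Ck_SucD:
  assumes "Ck (Suc k) f"
  shows "(f has_derivative frechet_derivative f (at x)) (at x)"
    and "b \<in> Basis \<Longrightarrow> Ck k (\<lambda>x. frechet_derivative f (at x) b)"
  using assms by (auto simp: differentiable_on_def frechet_derivative_works[symmetric])

lemma Ck_Suc_imp_Ck: "Ck (Suc k) f \<Longrightarrow> Ck k f"
proof (induction k arbitrary: f)
  case 0
  then show ?case by (simp add: differentiable_imp_continuous_on)
next
  case (Suc k)
  show ?case
    by (rule Ck_SucI, rule Ck_SucD(1)[OF Suc.prems]) (intro Suc.IH Ck_SucD(2)[OF Suc.prems])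
qed

lemma Ck_imp_continuous: "Ck k f \<Longrightarrow> continuous_on UNIV f"
  by (cases k) (auto simp: differentiable_imp_continuous_on)

lemma Ck_const: "Ck k (\<lambda>x. c)"
proof (induction k arbitrary: c)
  case (Suc k)
  show ?case by (rule Ck_SucI[where D = "\<lambda>_ _. 0"]) (auto intro: Suc)
qed simp

lemma Ck_add: "Ck k f \<Longrightarrow> Ck k g \<Longrightarrow> Ck k (\<lambda>x. f x + g x)"
proof (induction k arbitrary: f g)
  case (Suc k)
  show ?case
    by (rule Ck_SucI, rule has_derivative_add, (rule Ck_SucD(1)[OF Suc.prems(1)] Ck_SucD(1)[OF Suc.prems(2)])+)
       (intro Suc.IH Ck_SucD(2)[OF Suc.prems(1)] Ck_SucD(2)[OF Suc.prems(2)])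
qed (simp add: continuous_on_add)

lemma Ck_mult: "Ck k f \<Longrightarrow> Ck k g \<Longrightarrow> Ck k (\<lambda>x. f x * g x)"
proof (induction k arbitrary: f g)
  case (Suc k)
  show ?case
    by (rule Ck_SucI, rule has_derivative_mult, (rule Ck_SucD(1)[OF Suc.prems(1)] Ck_SucD(1)[OF Suc.prems(2)])+)
       (intro Ck_add Suc.IH Ck_SucD(2)[OF Suc.prems(1)] Ck_SucD(2)[OF Suc.prems(2)]
          Ck_Suc_imp_Ck[OF Suc.prems(1)] Ck_Suc_imp_Ck[OF Suc.prems(2)])
qed (simp add: continuous_on_mult)

lemma Ck_sum: "(\<And>i. i \<in> I \<Longrightarrow> Ck k (f i)) \<Longrightarrow> Ck k (\<lambda>x. \<Sum>i\<in>I. f i x)"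
  by (induction I rule: infinite_finite_induct) (auto simp: Ck_const Ck_add)

lemma linear_eq_sum_Basis:
  fixes f :: "'a::euclidean_space \<Rightarrow> real"
  assumes "linear f"
  shows "f x = (\<Sum>b\<in>Basis. (x \<bullet> b) * f b)"
proof -
  have "f x = f (\<Sum>b\<in>Basis. (x \<bullet> b) *\<^sub>R b)" by (simp add: euclidean_representation)
  also have "\<dots> = (\<Sum>b\<in>Basis. (x \<bullet> b) * f b)"
    using assms by (simp add: linear_sum linear_scale)
  finally show ?thesis .
qed

text \<open>\<open>Ck\<close> sees only basis directions, while the chain rule produces the
  direction \<open>L h\<close>. Expanding \<open>L h\<close> in the basis gives constant
  coefficients, and the induction hypothesis applies to each term. Affine maps cover the
  compositions used later: rescalings, rays and the projections of space-time.\<close>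

lemma Ck_compose_affine:
  fixes L :: "'a::euclidean_space \<Rightarrow> 'b::euclidean_space"
  assumes "bounded_linear L"
  shows "Ck k f \<Longrightarrow> Ck k (\<lambda>x. f (c + L x))"
proof (induction k arbitrary: f)
  case 0
  then show ?case
    using continuous_on_compose2[of UNIV f UNIV "\<lambda>x. c + L x"]
    by (simp add: continuous_on_add linear_continuous_on[OF assms])
next
  case (Suc k)
  let ?D = "\<lambda>x. frechet_derivative f (at x)"
  have D: "(f has_derivative ?D x) (at x)" for x
    by (rule Ck_SucD(1)[OF Suc.prems])
  have "((\<lambda>x. f (c + L x)) has_derivative (\<lambda>h. \<Sum>b\<in>Basis. (L h \<bullet> b) * ?D (c + L x) b)) (at x)" for x
  proof -
    have "((\<lambda>x. c + L x) has_derivative L) (at x)"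
      by (auto intro!: derivative_eq_intros bounded_linear_imp_has_derivative assms)
    from has_derivative_compose[OF this D]
    have "((\<lambda>x. f (c + L x)) has_derivative (\<lambda>h. ?D (c + L x) (L h))) (at x)" .
    moreover have "(\<lambda>h. ?D (c + L x) (L h)) = (\<lambda>h. \<Sum>b\<in>Basis. (L h \<bullet> b) * ?D (c + L x) b)"
      by (rule ext, rule linear_eq_sum_Basis[OF has_derivative_linear[OF D]])
    ultimately show ?thesis by (simp only:)
  qed
  then show ?case
  proof (rule Ck_SucI)
    fix h :: 'a
    show "Ck k (\<lambda>x. \<Sum>b\<in>Basis. (L h \<bullet> b) * ?D (c + L x) b)"
      by (intro Ck_sum Ck_mult Ck_const Suc.IH[OF Ck_SucD(2)[OF Suc.prems]])
  qed
qed

text \<open>This permits gluing. On the open set \<open>U\<close> the derivatives of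
  \<open>f\<close> and of the model \<open>g\<close> coincide, so the partial derivatives of
  \<open>g\<close> are local models for those of \<open>f\<close>.\<close>

lemma Ck_local:
  assumes "\<And>x. \<exists>U g. open U \<and> x \<in> U \<and> Ck k g \<and> (\<forall>y\<in>U. f y = g y)"
  shows "Ck k f"
  using assms
proof (induction k arbitrary: f)
  case 0
  have "isCont f x" for x
  proof -
    obtain U g where U: "open U" "x \<in> U" "continuous_on UNIV g" "\<forall>y\<in>U. f y = g y"
      using 0[of x] by auto
    have "continuous_on U f"
      using continuous_on_subset[OF U(3), of U] U(4) by (simp cong: continuous_on_cong)
    with U(1,2) show ?thesis by (simp add: continuous_on_eq_continuous_at)
  qed
  then show ?case by (simp add: continuous_on_eq_continuous_at)
next
  case (Suc k)
  have D: "(f has_derivative frechet_derivative g (at y)) (at y)"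
    if "open U" "y \<in> U" "Ck (Suc k) g" "\<forall>y\<in>U. f y = g y" for y U and g :: "'a \<Rightarrow> real"
    using has_derivative_transform_within_open[OF Ck_SucD(1)[OF that(3)] that(1,2)] that(4) by simp
  have "(f has_derivative frechet_derivative f (at x)) (at x)" for x
  proof -
    obtain U g where U: "open U" "x \<in> U" "Ck (Suc k) g" "\<forall>y\<in>U. f y = g y"
      using Suc.prems by blast
    from D[OF this] show ?thesis by (simp flip: frechet_derivative_at[OF D[OF U]])
  qed
  then show ?case
  proof (rule Ck_SucI)
    fix b :: 'a assume b: "b \<in> Basis"
    show "Ck k (\<lambda>x. frechet_derivative f (at x) b)"
    proof (rule Suc.IH)
      fix x
      obtain U g where U: "open U" "x \<in> U" "Ck (Suc k) g" "\<forall>y\<in>U. f y = g y"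
        using Suc.prems by blast
      then have "\<forall>y\<in>U. frechet_derivative f (at y) b = frechet_derivative g (at y) b"
        using frechet_derivative_at[OF D[OF U(1) _ U(3,4)]] by simp
      with U Ck_SucD(2)[OF U(3) b]
      show "\<exists>U g. open U \<and> x \<in> U \<and> Ck k g \<and> (\<forall>y\<in>U. frechet_derivative f (at y) b = g y)"
        by blast
    qed
  qed
qed

lemma smooth_has_derivative: "smooth f \<Longrightarrow> (f has_derivative frechet_derivative f (at x)) (at x)"
  by (rule Ck_SucD(1)[of 0]) (simp only: smooth_def)

lemma smooth_frechet_derivative: "smooth f \<Longrightarrow> b \<in> Basis \<Longrightarrow> smooth (\<lambda>x. frechet_derivative f (at x) b)"
  unfolding smooth_def by (intro allI Ck_SucD(2)) simp_all

lemma smooth_imp_continuous: "smooth f \<Longrightarrow> continuous_on UNIV f"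
  by (rule Ck_imp_continuous[of 0]) (simp only: smooth_def)

lemma gradI:
  assumes "(f has_derivative (\<lambda>h. h \<bullet> D)) (at x)"
  shows "grad f x = D"
  unfolding grad_def
proof (rule the_equality)
  show "GDERIV f x :> D" using assms by (simp add: gderiv_def)
  fix D' assume "GDERIV f x :> D'"
  then have "(\<lambda>h. h \<bullet> D') = (\<lambda>h. h \<bullet> D)"
    using has_derivative_unique[OF _ assms] by (simp add: gderiv_def)
  then show "D' = D" using vector_eq_ldot[of D' D] by (simp add: fun_eq_iff inner_commute)
qed

lemma smooth_grad:
  assumes "smooth f"
  shows "grad f x = (\<Sum>b\<in>Basis. frechet_derivative f (at x) b *\<^sub>R b)"
    and "(f has_derivative (\<lambda>h. h \<bullet> grad f x)) (at x)"
proof -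
  let ?g = "\<Sum>b\<in>Basis. frechet_derivative f (at x) b *\<^sub>R b"
  note D = smooth_has_derivative[OF assms, of x]
  have "frechet_derivative f (at x) = (\<lambda>h. h \<bullet> ?g)"
  proof
    fix h
    have "frechet_derivative f (at x) h = (\<Sum>b\<in>Basis. (h \<bullet> b) * frechet_derivative f (at x) b)"
      by (rule linear_eq_sum_Basis[OF has_derivative_linear[OF D]])
    then show "frechet_derivative f (at x) h = h \<bullet> ?g"
      by (simp add: inner_sum_right mult.commute)
  qed
  then have G: "GDERIV f x :> ?g" using D by (simp add: gderiv_def)
  then show *: "grad f x = ?g"  by (intro gradI) (simp add: gderiv_def)
  show "(f has_derivative (\<lambda>h. h \<bullet> grad f x)) (at x)" using G * by (simp add: gderiv_def)
qed

section \<open>Test functions\<close>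

lemma test_function_smooth: "test_function U f \<Longrightarrow> smooth f"
  by (simp add: test_function_def)

text \<open>A compact \<open>K\<close> is closed, so \<open>f\<close> vanishes on a neighbourhood of
  each point outside it; the same \<open>K\<close> thus serves for the derivative.\<close>

lemma test_function_frechet_derivative:
  assumes "test_function U f" and "b \<in> Basis"
  shows "test_function U (\<lambda>x. frechet_derivative f (at x) b)"
proof -
  obtain K where K: "compact K" "K \<subseteq> U" "\<And>x. x \<notin> K \<Longrightarrow> f x = 0" and f: "smooth f"
    using assms(1) by (auto simp: test_function_def)
  have "frechet_derivative f (at x) b = 0" if "x \<notin> K" for x
  proof -
    have "(f has_derivative (\<lambda>_. 0)) (at x)"
      by (rule has_derivative_transform_within_open[OF has_derivative_const[of 0], where s = "- K"])
         (use K that in \<open>auto simp: compact_imp_closed open_Compl\<close>)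
    then show ?thesis by (simp flip: frechet_derivative_at)
  qed
  with K smooth_frechet_derivative[OF f assms(2)] show ?thesis
    unfolding test_function_def by blast
qed

lemma smooth_compose_affine:
  "bounded_linear L \<Longrightarrow> smooth f \<Longrightarrow> smooth (\<lambda>x. f (c + L x))"
  by (simp add: smooth_def Ck_compose_affine)

lemma smooth_mult: "smooth f \<Longrightarrow> smooth g \<Longrightarrow> smooth (\<lambda>x. f x * g x)"
  by (simp add: smooth_def Ck_mult)

lemma test_function_bounded:
  fixes f :: "'a::euclidean_space \<Rightarrow> real"
  assumes "test_function U f"
  obtains B where "B \<ge> 0" "\<And>x. \<bar>f x\<bar> \<le> B"
proof -
  obtain K where K: "compact K" "\<And>x. x \<notin> K \<Longrightarrow> f x = 0" and f: "continuous_on UNIV f"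
    using assms smooth_imp_continuous by (auto simp: test_function_def)
  have "bounded (f ` K)"
    by (intro compact_imp_bounded compact_continuous_image K continuous_on_subset[OF f] subset_UNIV)
  then obtain B where "\<And>x. x \<in> K \<Longrightarrow> \<bar>f x\<bar> \<le> B"
    by (auto simp: bounded_iff)
  with K show ?thesis
    by (intro that[of "max B 0"]) (force simp: max_def)+
qed

lemma test_function_borel: "test_function U f \<Longrightarrow> f \<in> borel_measurable borel"
  by (auto simp: test_function_def intro!: borel_measurable_continuous_onI smooth_imp_continuous)

lemma test_function_integrable:
  fixes f :: "'a::euclidean_space \<Rightarrow> real"
  assumes "test_function U f"
  shows "integrable lebesgue f" and "integrable lebesgue (\<lambda>x. (f x)\<^sup>2)"
proof -
  obtain K where K: "compact K" "\<And>x. x \<notin> K \<Longrightarrow> f x = 0" and f: "continuous_on UNIV f"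
    using assms smooth_imp_continuous by (auto simp: test_function_def)
  have *: "integrable lebesgue g"
    if "continuous_on UNIV g" "\<And>x. x \<notin> K \<Longrightarrow> g x = 0" for g :: "'a \<Rightarrow> real"
  proof -
    have "integrable lborel (\<lambda>x. indicator K x *\<^sub>R g x)"
      by (rule borel_integrable_compact[OF K(1) continuous_on_subset[OF that(1)]]) simp
    also have "(\<lambda>x. indicator K x *\<^sub>R g x) = g"
      using that(2) by (fastforce simp: indicator_def)
    finally show ?thesis
      using that(1) by (simp add: integrable_completion borel_measurable_continuous_onI)
  qed
  show "integrable lebesgue f" by (rule *[OF f]) (use K in auto)
  show "integrable lebesgue (\<lambda>x. (f x)\<^sup>2)" 
    by (rule *) (use K f in \<open>auto intro!: continuous_intros\<close>)
qed

section \<open>Square-integrable functions\<close>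

text \<open>Integrability comes first, from the elementary bound of the product by the sum of the
  squares; it identifies the real integrals with nonnegative ones, for which Cauchy-Schwarz is
  applied.\<close>

lemma integrable_mult_L2:
  fixes f g :: "'a \<Rightarrow> real"
  assumes [measurable]: "f \<in> borel_measurable M" "g \<in> borel_measurable M"
    and "integrable M (\<lambda>x. (f x)\<^sup>2)" "integrable M (\<lambda>x. (g x)\<^sup>2)"
  shows "integrable M (\<lambda>x. f x * g x)"
    and "(LINT x|M. \<bar>f x * g x\<bar>) \<le> sqrt (LINT x|M. (f x)\<^sup>2) * sqrt (LINT x|M. (g x)\<^sup>2)"
proof -
  have "\<bar>f x * g x\<bar> \<le> (f x)\<^sup>2 + (g x)\<^sup>2" for x
    using sum_squares_bound[of "\<bar>f x\<bar>" "\<bar>g x\<bar>"] zero_le_power2[of "f x"] zero_le_power2[of "g x"]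
    unfolding abs_mult power2_abs by linarith
  then show *: "integrable M (\<lambda>x. f x * g x)"
    by (intro Bochner_Integration.integrable_bound[OF Bochner_Integration.integrable_add[OF assms(3,4)]]) auto
  let ?I = "LINT x|M. \<bar>f x * g x\<bar>" and ?F = "LINT x|M. (f x)\<^sup>2" and ?G = "LINT x|M. (g x)\<^sup>2"
  have "(\<integral>\<^sup>+x. ennreal \<bar>f x\<bar> * ennreal \<bar>g x\<bar> \<partial>M) = ennreal ?I"
    using nn_integral_eq_integral[OF integrable_abs[OF *]] by (simp add: abs_mult ennreal_mult)
  moreover have "(\<integral>\<^sup>+x. (ennreal \<bar>f x\<bar>)\<^sup>2 \<partial>M) = ennreal ?F" "(\<integral>\<^sup>+x. (ennreal \<bar>g x\<bar>)\<^sup>2 \<partial>M) = ennreal ?G"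
    using assms(3,4) by (simp_all add: nn_integral_eq_integral ennreal_power)
  ultimately have "(ennreal ?I)\<^sup>2 \<le> ennreal ?F * ennreal ?G"
    using Cauchy_Schwarz_nn_integral[of "\<lambda>x. ennreal \<bar>f x\<bar>" M "\<lambda>x. ennreal \<bar>g x\<bar>"] by simp
  then have "?I\<^sup>2 \<le> ?F * ?G"
    by (simp add: ennreal_power flip: ennreal_mult)
  then show "?I \<le> sqrt ?F * sqrt ?G"
    unfolding real_sqrt_mult[symmetric] by (rule real_le_rsqrt)
qed

lemma L2_norm_nonneg [simp]: "L2_norm f \<ge> 0"
  by (simp add: L2_norm_def)

lemma L2_norm_power2: "(L2_norm f)\<^sup>2 = (LINT x|lebesgue. (norm (f x))\<^sup>2)"
  by (simp add: L2_norm_def)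

lemma in_L2_mult:
  fixes f g :: "'a::euclidean_space \<Rightarrow> real"
  assumes "in_L2 f" "in_L2 g"
  shows "integrable lebesgue (\<lambda>x. f x * g x)"
    and "(LINT x|lebesgue. \<bar>f x * g x\<bar>) \<le> L2_norm f * L2_norm g"
    and "\<bar>LINT x|lebesgue. f x * g x\<bar> \<le> L2_norm f * L2_norm g"
proof -
  show "integrable lebesgue (\<lambda>x. f x * g x)"
    and *: "(LINT x|lebesgue. \<bar>f x * g x\<bar>) \<le> L2_norm f * L2_norm g"
    using assms integrable_mult_L2[of f lebesgue g] by (auto simp: in_L2_def L2_norm_def)
  show "\<bar>LINT x|lebesgue. f x * g x\<bar> \<le> L2_norm f * L2_norm g"
    by (rule order_trans[OF integral_abs_bound *])
qed

lemma in_L2_add: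
  fixes f g :: "'a::euclidean_space \<Rightarrow> real"
  assumes "in_L2 f" "in_L2 g"
  shows "in_L2 (\<lambda>x. f x + g x)"
  using assms in_L2_mult(1)[OF assms]
  by (auto simp: in_L2_def power2_sum mult.assoc intro!: Bochner_Integration.integrable_add)

lemma in_L2_cmult:
  fixes f :: "'a::euclidean_space \<Rightarrow> real"
  assumes "in_L2 f"
  shows "in_L2 (\<lambda>x. c * f x)"
  using assms by (auto simp: in_L2_def power_mult_distrib)

lemma in_L2_diff:
  fixes f g :: "'a::euclidean_space \<Rightarrow> real"
  assumes "in_L2 f" "in_L2 g"
  shows "in_L2 (\<lambda>x. f x - g x)"
  using in_L2_add[OF assms(1) in_L2_cmult[OF assms(2), of "-1"]] by simp

lemma test_function_in_L2:
  fixes f :: "'a::euclidean_space \<Rightarrow> real"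
  assumes "test_function U f"
  shows "in_L2 f"
  using test_function_integrable(2)[OF assms] test_function_borel[OF assms]
  by (simp add: in_L2_def measurable_completion)

lemma in_L1_Linf_imp_in_L2:
  fixes f :: "'a::euclidean_space \<Rightarrow> real"
  assumes "integrable lebesgue f" and "AE x in lebesgue. \<bar>f x\<bar> \<le> K"
  shows "in_L2 f" and "(L2_norm f)\<^sup>2 \<le> K * L1_norm f"
proof -
  have [measurable]: "f \<in> borel_measurable lebesgue" using assms(1) by auto
  have sq: "y\<^sup>2 \<le> K * \<bar>y\<bar>" if "\<bar>y\<bar> \<le> K" for y :: real
    using mult_right_mono[OF that, of "\<bar>y\<bar>"] by (simp add: power2_eq_square)
  have *: "AE x in lebesgue. norm ((f x)\<^sup>2) \<le> norm (K * \<bar>f x\<bar>)"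
    using assms(2) by eventually_elim (use sq in auto)
  have **: "integrable lebesgue (\<lambda>x. K * \<bar>f x\<bar>)" using assms(1) by simp
  have int: "integrable lebesgue (\<lambda>x. (f x)\<^sup>2)"
    by (rule Bochner_Integration.integrable_bound[OF ** _ *]) auto
  then show "in_L2 f" by (simp add: in_L2_def)
  have "(LINT x|lebesgue. (f x)\<^sup>2) \<le> (LINT x|lebesgue. K * \<bar>f x\<bar>)"
    using assms(2)
    by (intro integral_mono_AE int **) (auto simp: sq)
  then show "(L2_norm f)\<^sup>2 \<le> K * L1_norm f"
    by (simp add: L2_norm_power2 L1_norm_def)
qed

section \<open>Functionals along a continuous curve in L2\<close>

lemma continuous_L2_in_L2: "continuous_L2 T \<rho> \<Longrightarrow> t \<in> {0..T} \<Longrightarrow> in_L2 (\<rho> t)"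
  by (simp add: continuous_L2_def)

text \<open>By additivity the increment of \<open>\<beta>\<close> along the curve is
  \<open>\<beta>\<close> of the increment, which \<open>bound\<close> controls. Continuity obtained
  in this way is the source of measurability in time.\<close>

lemma continuous_on_linear_L2:
  fixes \<rho> :: "real \<Rightarrow> 'a::euclidean_space \<Rightarrow> real" and \<beta> :: "('a \<Rightarrow> real) \<Rightarrow> real"
  assumes \<rho>: "continuous_L2 T \<rho>"
    and add: "\<And>f g. in_L2 f \<Longrightarrow> in_L2 g \<Longrightarrow> \<beta> (\<lambda>x. f x + g x) = \<beta> f + \<beta> g"
    and bound: "\<And>f. in_L2 f \<Longrightarrow> \<bar>\<beta> f\<bar> \<le> c * L2_norm f"
  shows "continuous_on {0..T} (\<lambda>t. \<beta> (\<rho> t))"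
  unfolding continuous_on_def
proof
  fix t assume t: "t \<in> {0..T}"
  let ?F = "at t within {0..T}"
  have "((\<lambda>s. c * L2_norm (\<lambda>x. \<rho> s x - \<rho> t x)) \<longlongrightarrow> c * 0) ?F"
    using \<rho> t by (intro tendsto_mult_left) (auto simp: continuous_L2_def)
  then have g: "((\<lambda>s. c * L2_norm (\<lambda>x. \<rho> s x - \<rho> t x)) \<longlongrightarrow> 0) ?F" by simp
  have "((\<lambda>s. \<beta> (\<rho> s) - \<beta> (\<rho> t)) \<longlongrightarrow> 0) ?F"
  proof (rule Lim_null_comparison[OF _ g])
    show "\<forall>\<^sub>F s in ?F. norm (\<beta> (\<rho> s) - \<beta> (\<rho> t)) \<le> c * L2_norm (\<lambda>x. \<rho> s x - \<rho> t x)"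
      unfolding eventually_at_filter
    proof (intro always_eventually allI impI)
      fix s assume s: "s \<in> {0..T}"
      note L = continuous_L2_in_L2[OF \<rho> s] continuous_L2_in_L2[OF \<rho> t]
      have "\<beta> (\<lambda>x. (\<rho> s x - \<rho> t x) + \<rho> t x) = \<beta> (\<lambda>x. \<rho> s x - \<rho> t x) + \<beta> (\<rho> t)"
        by (intro add in_L2_diff L)
      then show "norm (\<beta> (\<rho> s) - \<beta> (\<rho> t)) \<le> c * L2_norm (\<lambda>x. \<rho> s x - \<rho> t x)"
        using bound[OF in_L2_diff[OF L]] by simp
    qed
  qed
  then show "((\<lambda>s. \<beta> (\<rho> s)) \<longlongrightarrow> \<beta> (\<rho> t)) ?F"
    by (rule LIM_zero_cancel)
qed

text \<open>With \<open>\<delta> = \<rho> s - \<rho> t\<close> the increment of the diagonal expands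
  into three terms, each having \<open>\<delta>\<close> in at least one slot; the summands of
  \<open>?g\<close> bound them one by one.\<close>

lemma continuous_on_bilinear_L2:
  fixes \<rho> :: "real \<Rightarrow> 'a::euclidean_space \<Rightarrow> real" and \<beta> :: "('a \<Rightarrow> real) \<Rightarrow> ('a \<Rightarrow> real) \<Rightarrow> real"
  assumes \<rho>: "continuous_L2 T \<rho>"
    and add_left: "\<And>f g h. in_L2 f \<Longrightarrow> in_L2 g \<Longrightarrow> in_L2 h \<Longrightarrow> \<beta> (\<lambda>x. f x + g x) h = \<beta> f h + \<beta> g h"
    and add_right: "\<And>f g h. in_L2 f \<Longrightarrow> in_L2 g \<Longrightarrow> in_L2 h \<Longrightarrow> \<beta> h (\<lambda>x. f x + g x) = \<beta> h f + \<beta> h g"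
    and bound: "\<And>f g. in_L2 f \<Longrightarrow> in_L2 g \<Longrightarrow> \<bar>\<beta> f g\<bar> \<le> c * L2_norm f * L2_norm g"
  shows "continuous_on {0..T} (\<lambda>t. \<beta> (\<rho> t) (\<rho> t))"
  unfolding continuous_on_def
proof
  fix t assume t: "t \<in> {0..T}"
  let ?F = "at t within {0..T}"
  let ?d = "\<lambda>s. L2_norm (\<lambda>x. \<rho> s x - \<rho> t x)"
  let ?g = "\<lambda>s. c * ?d s * ?d s + c * ?d s * L2_norm (\<rho> t) + c * L2_norm (\<rho> t) * ?d s"
  have d: "(?d \<longlongrightarrow> 0) ?F"
    using \<rho> t by (auto simp: continuous_L2_def)
  have "(?g \<longlongrightarrow> c * 0 * 0 + c * 0 * L2_norm (\<rho> t) + c * L2_norm (\<rho> t) * 0) ?F"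
    by (intro tendsto_intros d)
  then have g: "(?g \<longlongrightarrow> 0) ?F" by simp
  have "((\<lambda>s. \<beta> (\<rho> s) (\<rho> s) - \<beta> (\<rho> t) (\<rho> t)) \<longlongrightarrow> 0) ?F"
  proof (rule Lim_null_comparison[OF _ g])
    show "\<forall>\<^sub>F s in ?F. norm (\<beta> (\<rho> s) (\<rho> s) - \<beta> (\<rho> t) (\<rho> t)) \<le> ?g s"
      unfolding eventually_at_filter
    proof (intro always_eventually allI impI)
      fix s assume s: "s \<in> {0..T}"
      note L = continuous_L2_in_L2[OF \<rho> s] continuous_L2_in_L2[OF \<rho> t]
      define \<delta> where "\<delta> = (\<lambda>x. \<rho> s x - \<rho> t x)"
      have D: "in_L2 \<delta>" unfolding \<delta>_def by (intro in_L2_diff L)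
      have \<rho>s: "\<rho> s = (\<lambda>x. \<delta> x + \<rho> t x)" by (simp add: \<delta>_def)
      have "\<beta> (\<rho> s) (\<rho> s) = \<beta> \<delta> (\<rho> s) + \<beta> (\<rho> t) (\<rho> s)"
        using add_left[OF D L(2) L(1)] \<rho>s by simp
      also have "\<beta> \<delta> (\<rho> s) = \<beta> \<delta> \<delta> + \<beta> \<delta> (\<rho> t)"
        using add_right[OF D L(2) D] \<rho>s by simp
      also have "\<beta> (\<rho> t) (\<rho> s) = \<beta> (\<rho> t) \<delta> + \<beta> (\<rho> t) (\<rho> t)"
        using add_right[OF D L(2) L(2)] \<rho>s by simp
      finally show "norm (\<beta> (\<rho> s) (\<rho> s) - \<beta> (\<rho> t) (\<rho> t)) \<le> ?g s"
        using bound[OF D D] bound[OF D L(2)] bound[OF L(2) D] unfolding \<delta>_def[symmetric] real_norm_def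
        by linarith
    qed
  qed
  then show "((\<lambda>s. \<beta> (\<rho> s) (\<rho> s)) \<longlongrightarrow> \<beta> (\<rho> t) (\<rho> t)) ?F"
    by (rule LIM_zero_cancel)
qed

lemma continuous_on_integral_L2:
  assumes "continuous_L2 T \<rho>" and "in_L2 w"
  shows "continuous_on {0..T} (\<lambda>t. LINT x|lebesgue. \<rho> t x * w x)"
proof (rule continuous_on_linear_L2[OF assms(1)])
  show "\<bar>LINT x|lebesgue. f x * w x\<bar> \<le> L2_norm w * L2_norm f" if "in_L2 f" for f
    using in_L2_mult(3)[OF that assms(2)] by (simp add: mult.commute)
qed (simp add: distrib_right in_L2_mult(1)[OF _ assms(2)])

text \<open>The quadratic expression is the diagonal of the bilinear form with weight
  \<open>w\<close>, whose norm on L2 is at most \<open>B\<close>.\<close>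

lemma continuous_on_integral_square_L2:
  fixes \<rho> :: "real \<Rightarrow> 'a::euclidean_space \<Rightarrow> real"
  assumes "continuous_L2 T \<rho>" and [measurable]: "w \<in> borel_measurable lebesgue" and w: "\<And>x. \<bar>w x\<bar> \<le> B"
  shows "continuous_on {0..T} (\<lambda>t. LINT x|lebesgue. (\<rho> t x)\<^sup>2 * w x)"
proof -
  have int: "integrable lebesgue (\<lambda>x. f x * g x * w x)"
    and bound: "\<bar>LINT x|lebesgue. f x * g x * w x\<bar> \<le> B * L2_norm f * L2_norm g"
    if L: "in_L2 f" "in_L2 g" for f g :: "'a \<Rightarrow> real"
  proof -
    have [measurable]: "f \<in> borel_measurable lebesgue" "g \<in> borel_measurable lebesgue"
      using L by (auto simp: in_L2_def)
    have B: "B \<ge> 0" using w[of undefined] by simp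
    have le: "\<bar>f x * g x * w x\<bar> \<le> B * \<bar>f x * g x\<bar>" for x
      using mult_left_mono[OF w[of x], of "\<bar>f x * g x\<bar>"] by (simp add: abs_mult mult.commute)
    have int': "integrable lebesgue (\<lambda>x. B * \<bar>f x * g x\<bar>)"
      using in_L2_mult(1)[OF L] by auto
    show int: "integrable lebesgue (\<lambda>x. f x * g x * w x)"
      by (rule Bochner_Integration.integrable_bound[OF int']) (use le B in auto)
    have "\<bar>LINT x|lebesgue. f x * g x * w x\<bar> \<le> (LINT x|lebesgue. \<bar>f x * g x * w x\<bar>)"
      by (rule integral_abs_bound)
    also have "\<dots> \<le> (LINT x|lebesgue. B * \<bar>f x * g x\<bar>)"
      by (intro integral_mono integrable_abs int int' le)
    also have "\<dots> \<le> B * (L2_norm f * L2_norm g)"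
      using in_L2_mult(2)[OF L] B by (simp add: mult_left_mono)
    finally show "\<bar>LINT x|lebesgue. f x * g x * w x\<bar> \<le> B * L2_norm f * L2_norm g"
      by (simp add: mult.assoc)
  qed
  show ?thesis
    unfolding power2_eq_square
    by (rule continuous_on_bilinear_L2[OF assms(1) _ _ bound]) (simp_all add: ring_distribs int)
qed

section \<open>The gradient of the fundamental solution\<close>

text \<open>This is the gradient of the fundamental solution away from the origin. At the origin it
  is 0, whereas \<open>grad fundamental_solution 0\<close> is an unspecified value.\<close>

definition newton_kernel :: "'a::euclidean_space \<Rightarrow> 'a" where
  "newton_kernel z = (1 / (real DIM('a) * unit_ball_vol (real DIM('a)) * norm z ^ DIM('a))) *\<^sub>R z"

lemma unit_ball_vol_DIM_pos: "unit_ball_vol (real DIM('a::euclidean_space)) > 0"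
  by simp

lemma has_derivative_norm_at:
  fixes z :: "'a::euclidean_space"
  assumes "z \<noteq> 0"
  shows "(norm has_derivative (\<lambda>h. h \<bullet> z / norm z)) (at z)"
  using has_derivative_norm[OF assms] by (simp add: sgn_div_norm inner_commute divide_inverse_commute)

lemma grad_fundamental_solution:
  fixes z :: "'a::euclidean_space"
  assumes "DIM('a) \<ge> 2" and z: "z \<noteq> 0"
  shows "grad fundamental_solution z = newton_kernel z"
proof (rule gradI, cases "DIM('a) = 2")
  case True
  have "((\<lambda>x. ln (norm x) / (2 * pi)) has_derivative (\<lambda>h. (1 / norm z) * (h \<bullet> z / norm z) / (2 * pi))) (at z)"
    using z by (auto intro!: derivative_eq_intros has_derivative_norm_at simp: field_simps)
  moreover have "(\<lambda>x::'a. ln (norm x) / (2 * pi)) = fundamental_solution"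
    using True by (simp add: fundamental_solution_def fun_eq_iff)
  moreover have "(\<lambda>h. (1 / norm z) * (h \<bullet> z / norm z) / (2 * pi)) = (\<lambda>h. h \<bullet> newton_kernel z)"
    using True by (simp add: newton_kernel_def fun_eq_iff unit_ball_vol_2 power2_eq_square)
  ultimately show "(fundamental_solution has_derivative (\<lambda>h. h \<bullet> newton_kernel z)) (at z)"
    by simp
next
  case False
  define m where "m = DIM('a) - 2"
  have d: "DIM('a) = m + 2" and m: "m > 0" using assms False by (auto simp: m_def)
  define A where "A = - 1 / (real (m + 2) * real m * unit_ball_vol (real (m + 2)))"
  have "((\<lambda>x. A * inverse (norm x ^ m)) has_derivative
      (\<lambda>h. A * - (inverse (norm z ^ m) * (real m * (h \<bullet> z / norm z) * norm z ^ (m - 1)) * inverse (norm z ^ m)))) (at z)"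
    using z by (intro has_derivative_mult_right Deriv.has_derivative_inverse has_derivative_power has_derivative_norm_at) auto
  moreover have "(\<lambda>x::'a. A * inverse (norm x ^ m)) = fundamental_solution"
    using m d by (simp add: fundamental_solution_def fun_eq_iff A_def divide_inverse)
  moreover have "A * - (inverse (norm z ^ m) * (real m * (h \<bullet> z / norm z) * norm z ^ (m - 1)) * inverse (norm z ^ m))
    = h \<bullet> newton_kernel z" for h
  proof -
    \<comment> \<open>As a successor, \<open>m\<close> makes \<open>m - 1\<close> a true
      predecessor. The factor \<open>m\<close> from differentiating the power cancels the d - 2 in
      \<open>A\<close>, leaving the constant of \<open>newton_kernel\<close>.\<close>
    obtain k where k: "m = Suc k" using m by (cases m) auto
    have *: "- 1 / (e * M) * - (inverse (r ^ m) * (M * (q / r) * r ^ (m - 1)) * inverse (r ^ m)) = q / (e * r ^ (m + 2))"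
      if "e > 0" "M > 0" "r > 0" for e M r q :: real
      using that by (simp add: k field_simps)
    have "A * - (inverse (norm z ^ m) * (real m * (h \<bullet> z / norm z) * norm z ^ (m - 1)) * inverse (norm z ^ m))
       = (h \<bullet> z) / ((real (m + 2) * unit_ball_vol (real (m + 2))) * norm z ^ (m + 2))"
      using *[of "real (m + 2) * unit_ball_vol (real (m + 2))" "real m" "norm z" "h \<bullet> z"] z m
      by (simp add: A_def mult_ac)
    then show ?thesis by (simp add: newton_kernel_def d)
  qed
  ultimately show "(fundamental_solution has_derivative (\<lambda>h. h \<bullet> newton_kernel z)) (at z)"
    by simp
qed

lemma newton_kernel_borel [measurable]: "newton_kernel \<in> borel_measurable borel"
  unfolding newton_kernel_def by measurable

lemma norm_newton_kernel:
  fixes z :: "'a::euclidean_space"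
  assumes "DIM('a) \<ge> 2"
  shows "norm (newton_kernel z) = 1 / (real DIM('a) * unit_ball_vol (real DIM('a))) / norm z ^ (DIM('a) - 1)"
proof (cases "z = 0")
  \<comment> \<open>Both sides are 0: on the right the divisor is a positive power of 0, since the
    dimension is at least 2, and division by 0 yields 0.\<close>
  case True
  then show ?thesis using assms by (simp add: newton_kernel_def power_0_left)
next
  case False
  obtain m where m: "DIM('a) = Suc m" using assms by (cases "DIM('a)") auto
  define e where "e = real DIM('a) * unit_ball_vol (real DIM('a))"
  have "e > 0" using assms by (simp add: e_def)
  then have "norm (newton_kernel z) = 1 / (e * norm z ^ DIM('a)) * norm z"
    by (simp add: newton_kernel_def e_def)
  also have "\<dots> = 1 / e / norm z ^ (DIM('a) - 1)"
    using False \<open>e > 0\<close> by (simp add: m field_simps)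
  finally show ?thesis by (simp only: e_def)
qed

text \<open>The dyadic shells at distance \<open>2\<^sup>-\<^sup>j\<close> contribute a geometric series: each has volume of order
  \<open>2\<^sup>-\<^sup>j\<^sup>d\<close>, and the kernel is of order \<open>2\<^sup>j\<^sup>(\<^sup>d\<^sup>-\<^sup>1\<^sup>)\<close> there.\<close>

lemma nn_integral_newton_kernel_ball:
  fixes x :: "'a::euclidean_space"
  assumes dim: "DIM('a) \<ge> 2"
  shows "(\<integral>\<^sup>+y. ennreal (norm (newton_kernel (x - y))) * indicator (ball x 1) y \<partial>lebesgue)
    \<le> ennreal (2 ^ DIM('a))"
proof -
  obtain m where m: "DIM('a) = Suc m" using dim by (cases "DIM('a)") auto
  define \<omega> where "\<omega> = unit_ball_vol (real DIM('a))"
  have \<omega>: "\<omega> > 0" by (simp add: \<omega>_def)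
  \<comment> \<open>\<open>c * \<omega>\<close> equals 1/d and is estimated by 1. The geometric
    series sums to 2, which with \<open>2 ^ m\<close> gives the stated power of 2.\<close>
  define c where "c = 1 / (real DIM('a) * \<omega>)"
  have c: "c > 0" "c * \<omega> \<le> 1" using \<omega> dim by (auto simp: c_def)
  \<comment> \<open>Whole balls replace the shells: one dominating summand at each point is enough,
    and balls have an explicit volume. The exponent uses the inner radius,
    \<open>(1/2) ^ (j + 1)\<close>, of the shell.\<close>
  let ?t = "\<lambda>j y. ennreal (c * 2 ^ ((j + 1) * m)) * indicator (ball x ((1/2) ^ j)) y"
  have "ennreal (norm (newton_kernel (x - y))) * indicator (ball x 1) y \<le> (\<Sum>j. ?t j y)" for y
  proof (cases "y \<noteq> x \<and> dist x y < 1")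
    case False
    then show ?thesis by (auto simp: newton_kernel_def indicator_def)
  next
    case True
    define r where "r = norm (x - y)"
    have r: "0 < r" "r < 1" using True by (auto simp: r_def dist_norm)
    define j where "j = (LEAST j. (1/2) ^ (j + 1) \<le> r)"
    obtain n where "(1/2::real) ^ n < r" using real_arch_pow_inv[of r "1/2"] r by auto
    then have "\<exists>j. (1/2) ^ (j + 1) \<le> r"
      using r by (intro exI[of _ n]) simp
    then have j: "(1/2) ^ (j + 1) \<le> r" unfolding j_def by (rule LeastI_ex)
    have j': "r < (1/2) ^ j"
    proof (cases j)
      case 0
      then show ?thesis using r by simp
    next
      case (Suc i)
      then have "\<not> (1/2) ^ (i + 1) \<le> r" using not_less_Least[of i "\<lambda>j. (1/2) ^ (j + 1) \<le> r"] by (simp add: j_def)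
      then show ?thesis using Suc by simp
    qed
    have "((1/2) ^ (j + 1)) ^ m \<le> r ^ m" by (intro power_mono j) simp
    then have "c / r ^ m \<le> c / (((1/2) ^ (j + 1)) ^ m)"
      using c r by (intro divide_left_mono) auto
    also have "\<dots> = c * 2 ^ ((j + 1) * m)"
      by (simp add: power_mult power_one_over divide_simps power_add flip: power_mult)
    finally have "norm (newton_kernel (x - y)) \<le> c * 2 ^ ((j + 1) * m)"
      by (simp add: norm_newton_kernel[OF dim] c_def \<omega>_def r_def m)
    then have "ennreal (norm (newton_kernel (x - y))) * indicator (ball x 1) y \<le> ?t j y"
      using True j' by (auto simp: r_def dist_norm indicator_def intro: ennreal_leI)
    also have "\<dots> \<le> (\<Sum>j. ?t j y)"
    proof -
      define f where "f = (\<lambda>j. ?t j y)"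
      have "f j \<le> suminf f" using sum_le_suminf[of f "{j}"] by simp
      then show ?thesis by (simp only: f_def)
    qed
    finally show ?thesis .
  qed
  then have "(\<integral>\<^sup>+y. ennreal (norm (newton_kernel (x - y))) * indicator (ball x 1) y \<partial>lebesgue)
     \<le> (\<integral>\<^sup>+y. (\<Sum>j. ?t j y) \<partial>lborel)"
    unfolding nn_integral_completion by (rule nn_integral_mono)
  also have "\<dots> = (\<Sum>j. \<integral>\<^sup>+y. ?t j y \<partial>lborel)"
  proof (rule nn_integral_suminf)
    have [measurable]: "ball x r \<in> sets borel" for r by simp
    show "?t j \<in> borel_measurable lborel" for j by measurable
  qed
  also have "\<dots> = (\<Sum>j. ennreal (c * \<omega> * 2 ^ m * (1/2) ^ j))"
  proof (intro suminf_cong)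
    fix j
    have "(\<integral>\<^sup>+y. ?t j y \<partial>lborel) = ennreal (c * 2 ^ ((j + 1) * m)) * ennreal (\<omega> * ((1/2) ^ j) ^ Suc m)"
      by (subst nn_integral_cmult_indicator) (simp_all add: emeasure_ball \<omega>_def m)
    also have "\<dots> = ennreal ((c * 2 ^ ((j + 1) * m)) * (\<omega> * ((1/2) ^ j) ^ Suc m))"
      using c \<omega> by (simp add: ennreal_mult)
    also have "(c * 2 ^ ((j + 1) * m)) * (\<omega> * ((1/2) ^ j) ^ Suc m) = c * \<omega> * 2 ^ m * (1/2) ^ j"
      by (simp add: power_add power_mult power_one_over divide_simps flip: power_mult)
    finally show "(\<integral>\<^sup>+y. ?t j y \<partial>lborel) = ennreal (c * \<omega> * 2 ^ m * (1/2) ^ j)" .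
  qed
  also have "\<dots> = ennreal (\<Sum>j. c * \<omega> * 2 ^ m * (1/2) ^ j)"
    using c \<omega> by (intro suminf_ennreal2 summable_mult summable_geometric) auto
  also have "(\<Sum>j. c * \<omega> * 2 ^ m * (1/2) ^ j) = c * \<omega> * 2 ^ m * 2"
    by (simp add: suminf_mult suminf_geometric)
  also have "\<dots> \<le> 1 * 2 ^ m * 2"
    using c by (intro mult_right_mono) auto
  finally show ?thesis by (simp add: m ennreal_leI mult.commute)
qed

lemma norm_newton_kernel_far:
  fixes z :: "'a::euclidean_space"
  assumes "DIM('a) \<ge> 2" and "\<epsilon> > 0" "\<epsilon> \<le> norm z"
  shows "norm (newton_kernel z) \<le> 1 / unit_ball_vol (real DIM('a)) / \<epsilon> ^ (DIM('a) - 1)"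
  unfolding norm_newton_kernel[OF assms(1)]
proof (rule frac_le)
  show "1 / (real DIM('a) * unit_ball_vol (real DIM('a))) \<le> 1 / unit_ball_vol (real DIM('a))"
    using assms(1) unit_ball_vol_DIM_pos[where 'a='a] by (simp add: field_simps)
qed (use assms in \<open>auto intro: power_mono\<close>)

section \<open>Velocity and flux\<close>

text \<open>The kernel is a parameter, so that the Newton kernel and its truncations share one
  treatment of measurability and of the flux.\<close>

definition kernel_conv :: "('a \<Rightarrow> 'a) \<Rightarrow> ('a::euclidean_space \<Rightarrow> real) \<Rightarrow> 'a \<Rightarrow> 'a" where
  "kernel_conv \<kappa> f x = (LINT y|lebesgue. f y *\<^sub>R \<kappa> (x - y))"

lemma borel_imp_lebesgue_measurable:
  "f \<in> borel_measurable borel \<Longrightarrow> f \<in> borel_measurable lebesgue"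
  by (rule measurable_completion) simp

lemma translated_kernel_measurable:
  fixes f :: "'a::euclidean_space \<Rightarrow> real" and \<kappa> :: "'a \<Rightarrow> 'a"
  assumes "\<kappa> \<in> borel_measurable borel" and [measurable]: "f \<in> borel_measurable lebesgue"
  shows "(\<lambda>y. f y *\<^sub>R \<kappa> (x - y)) \<in> borel_measurable lebesgue"
proof -
  note [measurable] = assms(1)
  have [measurable]: "(\<lambda>y. \<kappa> (x - y)) \<in> borel_measurable lebesgue"
    by (rule borel_imp_lebesgue_measurable) measurable
  show ?thesis by measurable
qed

text \<open>Measurability of a parametrized integral needs an integrand measurable on the product,
  which a Lebesgue measurable \<open>f\<close> need not provide. Replacing \<open>f\<close> by an
  almost everywhere equal Borel function changes none of the integrals.\<close>

lemma kernel_conv_measurable: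
  fixes f :: "'a::euclidean_space \<Rightarrow> real" and \<kappa> :: "'a \<Rightarrow> 'a"
  assumes [measurable]: "\<kappa> \<in> borel_measurable borel" and f: "f \<in> borel_measurable lebesgue"
  shows "kernel_conv \<kappa> f \<in> borel_measurable borel"
proof -
  obtain g where [measurable]: "g \<in> borel_measurable lborel" and g: "AE y in lborel. f y = g y"
    using completion_ex_borel_measurable_real[OF f] by blast
  have g': "AE y in lebesgue. f y = g y" using g by (rule AE_completion)
  have gl: "g \<in> borel_measurable lebesgue" by (rule measurable_completion) measurable
  have "kernel_conv \<kappa> f x = (LINT y|lborel. g y *\<^sub>R \<kappa> (x - y))" for x
  proof -
    have "kernel_conv \<kappa> f x = (LINT y|lebesgue. g y *\<^sub>R \<kappa> (x - y))"
      unfolding kernel_conv_def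
      using g' by (intro integral_cong_AE translated_kernel_measurable assms f gl) auto
    also have "\<dots> = (LINT y|lborel. g y *\<^sub>R \<kappa> (x - y))"
      by (rule integral_completion) measurable
    finally show ?thesis .
  qed
  then have "kernel_conv \<kappa> f = (\<lambda>x. LINT y|lborel. g y *\<^sub>R \<kappa> (x - y))" by (rule ext)
  also have "\<dots> \<in> borel_measurable borel"
    by measurable
  finally show ?thesis .
qed

lemma AE_lebesgue_neq: "AE y in lebesgue. y \<noteq> (x::'a::euclidean_space)"
  by (rule AE_completion) (rule AE_lborel_singleton)

lemma velocity_eq_kernel_conv:
  fixes f :: "'a::euclidean_space \<Rightarrow> real"
  assumes dim: "DIM('a) \<ge> 2" and f: "f \<in> borel_measurable lebesgue"
  shows "velocity \<sigma> f x = \<sigma> *\<^sub>R kernel_conv newton_kernel f x"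
proof -
  let ?g = "grad fundamental_solution :: 'a \<Rightarrow> 'a"
  \<comment> \<open>The unspecified value at the origin is still one fixed vector, so the gradient
    is Borel; in the convolution it matters only on the null set \<open>y = x\<close>.\<close>
  have "?g = (\<lambda>z. if z = 0 then ?g 0 else newton_kernel z)"
    by (auto simp: grad_fundamental_solution[OF dim])
  moreover have "(\<lambda>z. if z = 0 then ?g 0 else newton_kernel z) \<in> borel_measurable borel"
    by measurable
  ultimately have "?g \<in> borel_measurable borel" by simp
  then have "(LINT y|lebesgue. f y *\<^sub>R ?g (x - y)) = kernel_conv newton_kernel f x"
    unfolding kernel_conv_def using AE_lebesgue_neq[of x]
    by (intro integral_cong_AE translated_kernel_measurable newton_kernel_borel f)
       (auto simp: grad_fundamental_solution[OF dim])
  then show ?thesis by (simp add: velocity_def)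
qed

text \<open>The first summand comes from the unit ball, where the supremum of the density multiplies
  the integral of the kernel; the second from its complement, where the supremum of the kernel
  multiplies the L1 norm. The type argument fixes the dimension.\<close>

definition velocity_bound :: "'a::euclidean_space itself \<Rightarrow> real \<Rightarrow> real" where
  "velocity_bound _ K = K * (2 ^ DIM('a) + 1 / unit_ball_vol (real DIM('a)))"

text \<open>The kernel is integrable near its singularity but not at infinity, and bounded away from
  the singularity. Hence the split at distance 1: the essential bound on \<open>f\<close> is used
  inside, its L1 norm outside.\<close>

lemma newton_kernel_conv:
  fixes f :: "'a::euclidean_space \<Rightarrow> real"
  assumes dim: "DIM('a) \<ge> 2" and f: "integrable lebesgue f" "AE x in lebesgue. \<bar>f x\<bar> \<le> K" "L1_norm f \<le> K"
  shows "integrable lebesgue (\<lambda>y. f y *\<^sub>R newton_kernel (x - y))"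
    and "(LINT y|lebesgue. norm (f y *\<^sub>R newton_kernel (x - y))) \<le> velocity_bound TYPE('a) K"
    and "norm (kernel_conv newton_kernel f x) \<le> velocity_bound TYPE('a) K"
proof -
  have [measurable]: "f \<in> borel_measurable lebesgue" using f(1) by auto
  let ?c = "1 / unit_ball_vol (real DIM('a))"
  let ?k = "\<lambda>y. ennreal (norm (newton_kernel (x - y))) * indicator (ball x 1) y"
  have c: "?c \<ge> 0" by simp
  have K: "K \<ge> 0" using f(3) by (rule order_trans[rotated]) (simp add: L1_norm_def)
  have [measurable]: "ball x 1 \<in> sets borel" by simp
  have [measurable]: "?k \<in> borel_measurable lebesgue"
    by (rule borel_imp_lebesgue_measurable) measurable
  have m: "(\<lambda>y. f y *\<^sub>R newton_kernel (x - y)) \<in> borel_measurable lebesgue"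
    by (rule translated_kernel_measurable) auto
  have "(\<integral>\<^sup>+y. norm (f y *\<^sub>R newton_kernel (x - y)) \<partial>lebesgue)
     \<le> (\<integral>\<^sup>+y. ennreal K * ?k y + ennreal ?c * ennreal \<bar>f y\<bar> \<partial>lebesgue)"
  proof (rule nn_integral_mono_AE, use f(2) in eventually_elim)
    fix y assume y: "\<bar>f y\<bar> \<le> K"
    show "ennreal (norm (f y *\<^sub>R newton_kernel (x - y))) \<le> ennreal K * ?k y + ennreal ?c * ennreal \<bar>f y\<bar>"
    proof (cases "y \<in> ball x 1")
      case True
      then have "ennreal (norm (f y *\<^sub>R newton_kernel (x - y))) \<le> ennreal K * ?k y"
        using y K by (simp add: mult_right_mono ennreal_leI flip: ennreal_mult)
      then show ?thesis by (rule order_trans) simp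
    next
      case False
      then have "norm (newton_kernel (x - y)) \<le> ?c"
        using norm_newton_kernel_far[OF dim, of 1 "x - y"] by (simp add: dist_norm)
      then have "ennreal (norm (f y *\<^sub>R newton_kernel (x - y))) \<le> ennreal (?c * \<bar>f y\<bar>)"
        using mult_right_mono[of "norm (newton_kernel (x - y))" ?c "\<bar>f y\<bar>"]
        by (intro ennreal_leI) (simp add: mult.commute)
      also have "\<dots> = ennreal ?c * ennreal \<bar>f y\<bar>"
        using c by (intro ennreal_mult) auto
      finally show ?thesis by (simp add: add_increasing)
    qed
  qed
  also have "\<dots> = ennreal K * (\<integral>\<^sup>+y. ?k y \<partial>lebesgue) + ennreal ?c * (\<integral>\<^sup>+y. ennreal \<bar>f y\<bar> \<partial>lebesgue)"
    by (subst nn_integral_add) (simp_all add: nn_integral_cmult)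
  also have "(\<integral>\<^sup>+y. ennreal \<bar>f y\<bar> \<partial>lebesgue) = ennreal (L1_norm f)"
    unfolding L1_norm_def using f(1) by (intro nn_integral_eq_integral) auto
  also have "ennreal K * (\<integral>\<^sup>+y. ?k y \<partial>lebesgue) + ennreal ?c * ennreal (L1_norm f)
     \<le> ennreal K * ennreal (2 ^ DIM('a)) + ennreal ?c * ennreal K"
    by (intro add_mono mult_left_mono nn_integral_newton_kernel_ball dim ennreal_leI f(3)) auto
  also have "\<dots> = ennreal (velocity_bound TYPE('a) K)"
  proof -
    have "velocity_bound TYPE('a) K = K * 2 ^ DIM('a) + ?c * K"
      by (simp add: velocity_bound_def algebra_simps)
    moreover have "ennreal (K * 2 ^ DIM('a)) = ennreal K * ennreal (2 ^ DIM('a))"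
      by (rule ennreal_mult) (use K in auto)
    moreover have "ennreal (?c * K) = ennreal ?c * ennreal K"
      by (rule ennreal_mult) (use K in auto)
    moreover have "ennreal (K * 2 ^ DIM('a) + ?c * K) = ennreal (K * 2 ^ DIM('a)) + ennreal (?c * K)"
      by (rule ennreal_plus) (use K in auto)
    ultimately show ?thesis by (simp only:)
  qed
  finally have *: "(\<integral>\<^sup>+y. norm (f y *\<^sub>R newton_kernel (x - y)) \<partial>lebesgue) \<le> ennreal (velocity_bound TYPE('a) K)" .
  then show int: "integrable lebesgue (\<lambda>y. f y *\<^sub>R newton_kernel (x - y))"
    by (intro integrableI_bounded m) (auto simp: less_top[symmetric] top_unique elim: order_le_less_trans)
  have V: "velocity_bound TYPE('a) K \<ge> 0"
    using K c by (simp add: velocity_bound_def)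
  show le: "(LINT y|lebesgue. norm (f y *\<^sub>R newton_kernel (x - y))) \<le> velocity_bound TYPE('a) K"
    using * V by (simp only: nn_integral_eq_integral[OF integrable_norm[OF int] AE_I2[OF norm_ge_zero]] ennreal_le_iff)
  show "norm (kernel_conv newton_kernel f x) \<le> velocity_bound TYPE('a) K"
    unfolding kernel_conv_def by (rule order_trans[OF integral_norm_bound le])
qed

text \<open>Cutting the kernel off near the origin and near infinity makes it square-integrable, so that
  the resulting flux is a bounded bilinear form on \<open>L\<^sup>2\<close>.\<close>

definition truncated_kernel :: "nat \<Rightarrow> 'a::euclidean_space \<Rightarrow> 'a" where
  "truncated_kernel n z = (if 1 / real (Suc n) \<le> norm z \<and> norm z \<le> real (Suc n) then newton_kernel z else 0)"

lemma truncated_kernel_borel [measurable]: "truncated_kernel n \<in> borel_measurable borel"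
  unfolding truncated_kernel_def by measurable

lemma norm_truncated_kernel_le: "norm (truncated_kernel n z) \<le> norm (newton_kernel z)"
  by (simp add: truncated_kernel_def)

lemma truncated_kernel_LIMSEQ: "(\<lambda>n. truncated_kernel n z) \<longlonglongrightarrow> newton_kernel z"
proof (cases "z = 0")
  case True
  then show ?thesis by (simp add: truncated_kernel_def newton_kernel_def)
next
  case False
  have "(\<lambda>n. 1 / real (Suc n)) \<longlonglongrightarrow> 0"
    by (rule LIMSEQ_Suc[OF lim_1_over_n])
  then have "\<forall>\<^sub>F n in sequentially. 1 / real (Suc n) < norm z"
    using False by (intro order_tendstoD) auto
  moreover have "\<forall>\<^sub>F n in sequentially. norm z \<le> real (Suc n)"
    by (meson eventually_sequentiallyI nat_ceiling_le_eq le_Suc_eq order.trans)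
  ultimately have "\<forall>\<^sub>F n in sequentially. truncated_kernel n z = newton_kernel z"
    by eventually_elim (simp add: truncated_kernel_def)
  then show ?thesis by (rule tendsto_eventually)
qed

text \<open>Truncation leaves a kernel bounded by \<open>b\<close> and supported in a ball of radius
  n + 1. \<open>B\<close> is the square root of \<open>b\<^sup>2\<close> times the volume of that
  ball, hence the same for every centre \<open>x\<close>.\<close>

lemma truncated_kernel_L2:
  assumes dim: "DIM('a::euclidean_space) \<ge> 2"
  obtains B where "B \<ge> 0"
    and "\<And>x::'a. integrable lebesgue (\<lambda>y. (norm (truncated_kernel n (x - y)))\<^sup>2)"
    and "\<And>x::'a. (LINT y|lebesgue. (norm (truncated_kernel n (x - y)))\<^sup>2) \<le> B\<^sup>2"
proof -
  let ?r = "real (Suc n)"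
  define b where "b = 1 / unit_ball_vol (real DIM('a)) / (1 / ?r) ^ (DIM('a) - 1)"
  define B where "B = sqrt (b\<^sup>2 * (unit_ball_vol (real DIM('a)) * ?r ^ DIM('a)))"
  have int: "integrable lebesgue (\<lambda>y. b\<^sup>2 * indicator (cball x ?r) y)" for x :: 'a
    by (intro integrable_mult_right) (simp add: emeasure_cball)
  have le: "(norm (truncated_kernel n (x - y)))\<^sup>2 \<le> b\<^sup>2 * indicator (cball x ?r) y" for x y :: 'a
    using norm_newton_kernel_far[OF dim, of "1 / ?r" "x - y"]
    by (auto simp: truncated_kernel_def b_def indicator_def dist_norm intro: power_mono)
  have m: "(\<lambda>y. (norm (truncated_kernel n (x - y)))\<^sup>2) \<in> borel_measurable lebesgue" for x :: 'a
    by (rule borel_imp_lebesgue_measurable) measurable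
  have int': "integrable lebesgue (\<lambda>y. (norm (truncated_kernel n (x - y)))\<^sup>2)" for x :: 'a
    by (rule Bochner_Integration.integrable_bound[OF int m]) (use le in auto)
  show thesis
  proof
    show "B \<ge> 0" by (simp add: B_def)
    show "integrable lebesgue (\<lambda>y. (norm (truncated_kernel n (x - y)))\<^sup>2)" for x :: 'a
      by (rule int')
    have "(LINT y|lebesgue. (norm (truncated_kernel n (x - y)))\<^sup>2) \<le> (LINT y|lebesgue. b\<^sup>2 * indicator (cball x ?r) y)" for x :: 'a
      by (intro integral_mono int int' le)
    also have "(LINT y|lebesgue. b\<^sup>2 * indicator (cball x ?r) y) = B\<^sup>2" for x :: 'a
      by (simp add: B_def content_cball)
    finally show "(LINT y|lebesgue. (norm (truncated_kernel n (x - y)))\<^sup>2) \<le> B\<^sup>2" for x :: 'a .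
  qed
qed

text \<open>The transported density \<open>f\<close> and the density \<open>g\<close> generating the
  velocity are kept apart, which makes this a bilinear form; the equation uses its diagonal, with
  \<open>w\<close> the gradient of a cutoff.\<close>

definition flux :: "('a \<Rightarrow> 'a) \<Rightarrow> ('a \<Rightarrow> 'a) \<Rightarrow> ('a::euclidean_space \<Rightarrow> real) \<Rightarrow> ('a \<Rightarrow> real) \<Rightarrow> real" where
  "flux \<kappa> w f g = (LINT x|lebesgue. f x * (kernel_conv \<kappa> g x \<bullet> w x))"

text \<open>Cauchy-Schwarz in \<open>y\<close> turns the L2 bound on the truncated kernel into a
  supremum bound on the velocity in terms of the L2 norm of the density alone.\<close>

lemma truncated_kernel_conv:
  fixes g :: "'a::euclidean_space \<Rightarrow> real"
  assumes g: "in_L2 g" and B: "B \<ge> 0"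
    and int: "integrable lebesgue (\<lambda>y. (norm (truncated_kernel n (x - y)))\<^sup>2)"
    and le: "(LINT y|lebesgue. (norm (truncated_kernel n (x - y)))\<^sup>2) \<le> B\<^sup>2"
  shows "integrable lebesgue (\<lambda>y. g y *\<^sub>R truncated_kernel n (x - y))"
    and "norm (kernel_conv (truncated_kernel n) g x) \<le> B * L2_norm g"
proof -
  have [measurable]: "g \<in> borel_measurable lebesgue" using g by (simp add: in_L2_def)
  have [measurable]: "(\<lambda>y. norm (truncated_kernel n (x - y))) \<in> borel_measurable lebesgue"
    by (rule borel_imp_lebesgue_measurable) measurable
  have i: "integrable lebesgue (\<lambda>y. (g y)\<^sup>2)" using g by (simp add: in_L2_def)
  note L = integrable_mult_L2[OF _ _ i int]
  have "integrable lebesgue (\<lambda>y. norm (g y *\<^sub>R truncated_kernel n (x - y)))"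
    using integrable_abs[OF L(1)] by (simp add: abs_mult)
  then show int': "integrable lebesgue (\<lambda>y. g y *\<^sub>R truncated_kernel n (x - y))"
    by (rule integrable_norm_cancel) (rule translated_kernel_measurable; measurable)
  have "norm (kernel_conv (truncated_kernel n) g x) \<le> (LINT y|lebesgue. norm (g y *\<^sub>R truncated_kernel n (x - y)))"
    unfolding kernel_conv_def by (rule integral_norm_bound)
  also have "\<dots> = (LINT y|lebesgue. \<bar>g y * norm (truncated_kernel n (x - y))\<bar>)"
    by (simp add: abs_mult)
  also have "\<dots> \<le> sqrt (LINT y|lebesgue. (g y)\<^sup>2) * sqrt (LINT y|lebesgue. (norm (truncated_kernel n (x - y)))\<^sup>2)"
    by (rule L(2)) measurable
  also have "\<dots> \<le> sqrt (LINT y|lebesgue. (g y)\<^sup>2) * B"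
    by (intro mult_left_mono real_le_lsqrt le B) auto
  finally show "norm (kernel_conv (truncated_kernel n) g x) \<le> B * L2_norm g"
    by (simp add: L2_norm_def mult.commute)
qed

text \<open>The truncated velocity is bounded by \<open>B * L2_norm g\<close>, and a second
  Cauchy-Schwarz pairs \<open>f\<close> with the square-integrable \<open>w\<close>. So the form is
  bounded on L2 and its diagonal is continuous along the curve.\<close>

lemma continuous_on_truncated_flux:
  fixes \<rho> :: "real \<Rightarrow> 'a::euclidean_space \<Rightarrow> real" and w :: "'a \<Rightarrow> 'a"
  assumes dim: "DIM('a) \<ge> 2" and \<rho>: "continuous_L2 T \<rho>"
    and [measurable]: "w \<in> borel_measurable borel" and w: "integrable lebesgue (\<lambda>x. (norm (w x))\<^sup>2)"
  shows "continuous_on {0..T} (\<lambda>t. flux (truncated_kernel n) w (\<rho> t) (\<rho> t))"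
proof -
  let ?\<kappa> = "truncated_kernel n :: 'a \<Rightarrow> 'a"
  obtain B where B: "B \<ge> 0"
      "\<And>x::'a. integrable lebesgue (\<lambda>y. (norm (?\<kappa> (x - y)))\<^sup>2)"
      "\<And>x::'a. (LINT y|lebesgue. (norm (?\<kappa> (x - y)))\<^sup>2) \<le> B\<^sup>2"
    using truncated_kernel_L2[OF dim] by metis
  have L2w: "in_L2 (\<lambda>x. norm (w x))"
    using w borel_imp_lebesgue_measurable[of "\<lambda>x. norm (w x)"] by (simp add: in_L2_def)
  have v: "integrable lebesgue (\<lambda>y. g y *\<^sub>R ?\<kappa> (x - y))" "norm (kernel_conv ?\<kappa> g x) \<le> B * L2_norm g"
    if "in_L2 g" for g x
    by (rule truncated_kernel_conv[OF that B])+
  have int: "integrable lebesgue (\<lambda>x. f x * (kernel_conv ?\<kappa> g x \<bullet> w x))"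
    and bound: "\<bar>flux ?\<kappa> w f g\<bar> \<le> (B * L2_norm (\<lambda>x. norm (w x))) * L2_norm f * L2_norm g"
    if f: "in_L2 f" and g: "in_L2 g" for f g
  proof -
    have [measurable]: "f \<in> borel_measurable lebesgue" "g \<in> borel_measurable lebesgue"
      using f g by (auto simp: in_L2_def)
    have "(\<lambda>x. kernel_conv ?\<kappa> g x \<bullet> w x) \<in> borel_measurable lebesgue"
      using kernel_conv_measurable[of ?\<kappa> g] by (intro borel_imp_lebesgue_measurable) simp
    then have m: "(\<lambda>x. f x * (kernel_conv ?\<kappa> g x \<bullet> w x)) \<in> borel_measurable lebesgue"
      by measurable
    have i: "integrable lebesgue (\<lambda>x. (B * L2_norm g) * \<bar>f x * norm (w x)\<bar>)"
      using in_L2_mult(1)[OF f L2w] by auto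
    have le: "\<bar>f x * (kernel_conv ?\<kappa> g x \<bullet> w x)\<bar> \<le> (B * L2_norm g) * \<bar>f x * norm (w x)\<bar>" for x
    proof -
      have "\<bar>kernel_conv ?\<kappa> g x \<bullet> w x\<bar> \<le> (B * L2_norm g) * norm (w x)"
        using Cauchy_Schwarz_ineq2 mult_right_mono[OF v(2)[OF g], of "norm (w x)"] by (rule order_trans) simp
      then show ?thesis
        using mult_left_mono[of _ _ "\<bar>f x\<bar>"] by (fastforce simp: abs_mult mult_ac)
    qed
    show int: "integrable lebesgue (\<lambda>x. f x * (kernel_conv ?\<kappa> g x \<bullet> w x))"
      by (rule Bochner_Integration.integrable_bound[OF i m]) (use le B in auto)
    have "\<bar>flux ?\<kappa> w f g\<bar> \<le> (LINT x|lebesgue. \<bar>f x * (kernel_conv ?\<kappa> g x \<bullet> w x)\<bar>)"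
      unfolding flux_def by (rule integral_abs_bound)
    also have "\<dots> \<le> (LINT x|lebesgue. (B * L2_norm g) * \<bar>f x * norm (w x)\<bar>)"
      by (intro integral_mono integrable_abs int i le)
    also have "\<dots> \<le> (B * L2_norm g) * (L2_norm f * L2_norm (\<lambda>x. norm (w x)))"
      using in_L2_mult(2)[OF f L2w] B(1) by (simp add: mult_left_mono)
    finally show "\<bar>flux ?\<kappa> w f g\<bar> \<le> (B * L2_norm (\<lambda>x. norm (w x))) * L2_norm f * L2_norm g"
      by (simp add: mult_ac)
  qed
  have add: "kernel_conv ?\<kappa> (\<lambda>x. f x + g x) x = kernel_conv ?\<kappa> f x + kernel_conv ?\<kappa> g x"
    if "in_L2 f" "in_L2 g" for f g x
    using v(1)[OF that(1)] v(1)[OF that(2)] by (simp add: kernel_conv_def scaleR_add_left)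
  show ?thesis
  proof (rule continuous_on_bilinear_L2[OF \<rho> _ _ bound])
    fix f g h :: "'a \<Rightarrow> real" assume L: "in_L2 f" "in_L2 g" "in_L2 h"
    show "flux ?\<kappa> w (\<lambda>x. f x + g x) h = flux ?\<kappa> w f h + flux ?\<kappa> w g h"
      unfolding flux_def distrib_right by (intro Bochner_Integration.integral_add int L)
    show "flux ?\<kappa> w h (\<lambda>x. f x + g x) = flux ?\<kappa> w h f + flux ?\<kappa> w h g"
      unfolding flux_def add[OF L(1,2)] inner_add_left distrib_left
      by (intro Bochner_Integration.integral_add int L)
  qed
qed

text \<open>The limit takes two dominated convergences: in \<open>y\<close>, below the full Newton
  kernel, for the velocity at each point; then in \<open>x\<close>, below a multiple of
  \<open>\<bar>f x\<bar>\<close>, for the flux.\<close>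

lemma newton_flux:
  fixes f :: "'a::euclidean_space \<Rightarrow> real" and w :: "'a \<Rightarrow> 'a"
  assumes dim: "DIM('a) \<ge> 2"
    and f: "integrable lebesgue f" "AE x in lebesgue. \<bar>f x\<bar> \<le> K" "L1_norm f \<le> K"
    and [measurable]: "w \<in> borel_measurable borel" and w: "\<And>x. norm (w x) \<le> G"
  shows "integrable lebesgue (\<lambda>x. f x * (kernel_conv newton_kernel f x \<bullet> w x))"
    and "\<bar>flux newton_kernel w f f\<bar> \<le> velocity_bound TYPE('a) K * G * K"
    and "(\<lambda>n. flux (truncated_kernel n) w f f) \<longlonglongrightarrow> flux newton_kernel w f f"
proof -
  let ?V = "velocity_bound TYPE('a) K"
  have [measurable]: "f \<in> borel_measurable lebesgue" using f(1) by auto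
  note nk = newton_kernel_conv[OF dim f]
  have V: "?V \<ge> 0" using norm_ge_zero nk(3) by (rule order_trans)
  have G: "G \<ge> 0" using norm_ge_zero w by (rule order_trans)
  have m: "(\<lambda>x. f x * (kernel_conv \<kappa> f x \<bullet> w x)) \<in> borel_measurable lebesgue"
    if "\<kappa> \<in> borel_measurable borel" for \<kappa>
  proof -
    have "(\<lambda>x. kernel_conv \<kappa> f x \<bullet> w x) \<in> borel_measurable lebesgue"
      using kernel_conv_measurable[OF that, of f] by (intro borel_imp_lebesgue_measurable) simp
    then show ?thesis by measurable
  qed
  have i: "integrable lebesgue (\<lambda>x. (?V * G) * \<bar>f x\<bar>)" using f(1) by simp
  have le: "\<bar>f x * (v \<bullet> w x)\<bar> \<le> (?V * G) * \<bar>f x\<bar>" if "norm v \<le> ?V" for v x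
  proof -
    have "\<bar>v \<bullet> w x\<bar> \<le> ?V * G"
      using Cauchy_Schwarz_ineq2 mult_mono[OF that w V norm_ge_zero] by (rule order_trans)
    then show ?thesis
      using mult_left_mono[of "\<bar>v \<bullet> w x\<bar>" "?V * G" "\<bar>f x\<bar>"] by (simp add: abs_mult mult.commute)
  qed
  show int: "integrable lebesgue (\<lambda>x. f x * (kernel_conv newton_kernel f x \<bullet> w x))"
    by (rule Bochner_Integration.integrable_bound[OF i m]) (use le[OF nk(3)] V G in auto)
  have "\<bar>flux newton_kernel w f f\<bar> \<le> (LINT x|lebesgue. \<bar>f x * (kernel_conv newton_kernel f x \<bullet> w x)\<bar>)"
    unfolding flux_def by (rule integral_abs_bound)
  also have "\<dots> \<le> (LINT x|lebesgue. (?V * G) * \<bar>f x\<bar>)"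
    by (intro integral_mono integrable_abs int i le nk(3))
  also have "\<dots> = (?V * G) * L1_norm f" by (simp add: L1_norm_def)
  also have "\<dots> \<le> (?V * G) * K" using f(3) V G by (intro mult_left_mono) auto
  finally show "\<bar>flux newton_kernel w f f\<bar> \<le> ?V * G * K" .
  \<comment> \<open>Norms are compared under the integral sign, so the bound is the same for all
    \<open>n\<close> and one majorant serves the whole sequence.\<close>
  have trunc_le: "norm (kernel_conv (truncated_kernel n) f x) \<le> ?V" for n x
  proof -
    have "norm (kernel_conv (truncated_kernel n) f x) \<le> (LINT y|lebesgue. norm (f y *\<^sub>R newton_kernel (x - y)))"
      unfolding kernel_conv_def
    proof (rule order_trans[OF integral_norm_bound integral_mono_AE])
      show "integrable lebesgue (\<lambda>y. norm (f y *\<^sub>R truncated_kernel n (x - y)))"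
      proof (rule Bochner_Integration.integrable_bound[OF nk(1)[of x]])
        show "(\<lambda>y. norm (f y *\<^sub>R truncated_kernel n (x - y))) \<in> borel_measurable lebesgue"
        proof -
          have [measurable]: "(\<lambda>y. f y *\<^sub>R truncated_kernel n (x - y)) \<in> borel_measurable lebesgue"
            by (rule translated_kernel_measurable) auto
          show ?thesis by measurable
        qed
      qed (auto intro!: mult_left_mono norm_truncated_kernel_le)
      show "integrable lebesgue (\<lambda>y. norm (f y *\<^sub>R newton_kernel (x - y)))"
        by (rule integrable_norm[OF nk(1)])
    qed (auto intro!: mult_left_mono norm_truncated_kernel_le)
    also have "\<dots> \<le> ?V"
      by (rule nk(2))
    finally show ?thesis .
  qed
  have lim: "(\<lambda>n. kernel_conv (truncated_kernel n) f x) \<longlonglongrightarrow> kernel_conv newton_kernel f x" for x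
    unfolding kernel_conv_def
  proof (rule integral_dominated_convergence[where w = "\<lambda>y. norm (f y *\<^sub>R newton_kernel (x - y))"])
    show "integrable lebesgue (\<lambda>y. norm (f y *\<^sub>R newton_kernel (x - y)))"
      using nk(1) by (rule integrable_norm)
    show "AE y in lebesgue. (\<lambda>n. f y *\<^sub>R truncated_kernel n (x - y)) \<longlonglongrightarrow> f y *\<^sub>R newton_kernel (x - y)"
      by (intro AE_I2 tendsto_scaleR tendsto_const truncated_kernel_LIMSEQ)
  qed (auto intro!: translated_kernel_measurable mult_left_mono norm_truncated_kernel_le)
  show "(\<lambda>n. flux (truncated_kernel n) w f f) \<longlonglongrightarrow> flux newton_kernel w f f"
    unfolding flux_def
  proof (rule integral_dominated_convergence[OF m m i])
    show "AE x in lebesgue. (\<lambda>n. f x * (kernel_conv (truncated_kernel n) f x \<bullet> w x))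
        \<longlonglongrightarrow> f x * (kernel_conv newton_kernel f x \<bullet> w x)"
      by (intro AE_I2 tendsto_intros lim)
  qed (use le[OF trunc_le] in auto)
qed

section \<open>Weak derivatives in time\<close>

lemma smooth_has_real_derivative:
  fixes \<theta> :: "real \<Rightarrow> real"
  assumes "smooth \<theta>"
  shows "(\<theta> has_real_derivative deriv \<theta> t) (at t)" and "continuous_on UNIV (deriv \<theta>)"
proof -
  have D: "(\<theta> has_real_derivative frechet_derivative \<theta> (at t) 1) (at t)" for t
  proof -
    have "frechet_derivative \<theta> (at t) = (*) (frechet_derivative \<theta> (at t) 1)"
    proof
      fix x :: real
      have "frechet_derivative \<theta> (at t) x = (\<Sum>b\<in>Basis. (x \<bullet> b) * frechet_derivative \<theta> (at t) b)"
        by (rule linear_eq_sum_Basis[OF has_derivative_linear[OF smooth_has_derivative[OF assms]]])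
      then show "frechet_derivative \<theta> (at t) x = frechet_derivative \<theta> (at t) 1 * x"
        by (simp add: mult.commute)
    qed
    then show ?thesis
      using smooth_has_derivative[OF assms, of t] by (simp add: has_field_derivative_def)
  qed
  then have eq: "deriv \<theta> = (\<lambda>t. frechet_derivative \<theta> (at t) 1)"
    using DERIV_imp_deriv by blast
  show "(\<theta> has_real_derivative deriv \<theta> t) (at t)" using D eq by simp
  show "continuous_on UNIV (deriv \<theta>)"
    unfolding eq by (intro smooth_imp_continuous smooth_frechet_derivative assms) simp
qed

section \<open>Cutoffs and a smooth step on the line\<close>

lemma cutoffD:
  assumes "cutoff a"
  shows "smooth a" and "norm x \<ge> 2 \<Longrightarrow> a x = 0" and "norm x < 1 \<Longrightarrow> a x = 1"
    and "norm x \<le> norm y \<Longrightarrow> a y \<le> a x"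
proof -
  have "(\<forall>x. x \<notin> ball 0 2 \<longrightarrow> a x = 0)" "\<forall>x\<in>ball 0 1. a x = 1"
    "\<forall>x y. norm x \<le> norm y \<longrightarrow> a y \<le> a x" and "smooth a"
    using assms unfolding cutoff_def by argo+
  then show "smooth a" and "norm x \<ge> 2 \<Longrightarrow> a x = 0" and "norm x < 1 \<Longrightarrow> a x = 1"
    and "norm x \<le> norm y \<Longrightarrow> a y \<le> a x"
    by simp_all
qed

text \<open>Radial monotonicity gives both: compare \<open>x\<close> with a point of norm at least
  2, where \<open>a\<close> vanishes, and with the origin, where it is 1.\<close>

lemma cutoff_bounds:
  assumes "cutoff a"
  shows "0 \<le> a x" and "a x \<le> 1"
proof -
  obtain y :: 'a where y: "norm y = 2 + norm x"
    using vector_choose_size[of "2 + norm x"] by auto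
  have "a y = 0" "a y \<le> a x"
    using y cutoffD(2)[OF assms, of y] cutoffD(4)[OF assms, of x y] by simp_all
  then show "0 \<le> a x" by simp
  show "a x \<le> 1"
    using cutoffD(4)[OF assms, of 0 x] cutoffD(3)[OF assms, of 0] by simp
qed

text \<open>Along the ray \<open>b + s *\<^sub>R b\<close> the norm is the absolute value of 1 + s,
  so \<open>a\<close> descends from 1 to 0 for s between 0 and 1. Far to the left the line leaves
  the support of \<open>a\<close> again, which is why \<open>\<eta>\<close> is set to 1 for negative
  arguments.\<close>

lemma smooth_step_exists:
  assumes "cutoff (a :: 'a::euclidean_space \<Rightarrow> real)"
  obtains \<eta> :: "real \<Rightarrow> real" where "smooth \<eta>" "\<And>s. s \<le> 0 \<Longrightarrow> \<eta> s = 1" "\<And>s. s \<ge> 1 \<Longrightarrow> \<eta> s = 0"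
    "\<And>s. 0 \<le> \<eta> s" "\<And>s. \<eta> s \<le> 1"
proof -
  obtain b :: 'a where b: "b \<in> Basis" using nonempty_Basis by blast
  define h where "h = (\<lambda>s. a (b + s *\<^sub>R b))"
  define \<eta> where "\<eta> = (\<lambda>s. if s < 0 then 1 else h s)"
  have norm: "norm (b + s *\<^sub>R b) = \<bar>1 + s\<bar>" for s
  proof -
    have "b + s *\<^sub>R b = (1 + s) *\<^sub>R b" by (simp add: scaleR_add_left)
    then show ?thesis using b by (simp only: norm_scaleR norm_Basis mult_1_right)
  qed
  have h: "smooth h"
    unfolding h_def using assms by (intro smooth_compose_affine bounded_linear_scaleR_left cutoffD(1))
  have h1: "h s = 1" if "-1 < s" "s < 0" for s
    using cutoffD(3)[OF assms, of "b + s *\<^sub>R b"] norm[of s] that by (simp add: h_def)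
  have h0: "h s = 0" if "1 \<le> s" for s
    using cutoffD(2)[OF assms, of "b + s *\<^sub>R b"] norm[of s] that by (simp add: h_def)
  \<comment> \<open>The negative half-line with the constant 1 and \<open>{-1<..}\<close> with
    \<open>h\<close> form an open cover; on the overlap the ray lies in the unit ball, where
    \<open>h\<close> is 1.\<close>
  have "Ck k \<eta>" for k
  proof (rule Ck_local)
    fix s :: real
    show "\<exists>U g. open U \<and> s \<in> U \<and> Ck k g \<and> (\<forall>y\<in>U. \<eta> y = g y)"
    proof (cases "s < 0")
      case True
      then show ?thesis
        by (intro exI[of _ "{..<0}"] exI[of _ "\<lambda>_. 1"]) (simp add: \<eta>_def Ck_const)
    next
      case False
      then show ?thesis using h
        by (intro exI[of _ "{-1<..}"] exI[of _ h]) (auto simp: \<eta>_def smooth_def h1)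
    qed
  qed
  then have "smooth \<eta>" by (simp add: smooth_def)
  moreover have "\<eta> s = 1" if "s \<le> 0" for s
  \<comment> \<open>At 0 the ray meets the unit sphere, outside the open ball on which
    \<open>a\<close> is prescribed; the value there is the limit from the left.\<close>
  proof (cases "s = 0")
    case True
    have "isCont \<eta> 0" using smooth_imp_continuous[OF \<open>smooth \<eta>\<close>] by (simp add: continuous_on_eq_continuous_at)
    then have "(\<eta> \<longlongrightarrow> \<eta> 0) (at_left 0)"
      by (simp add: continuous_within filterlim_at_split)
    moreover have "(\<eta> \<longlongrightarrow> 1) (at_left 0)"
      by (rule tendsto_eventually) (auto simp: eventually_at_filter \<eta>_def)
    ultimately show ?thesis
      using True tendsto_unique[of "at_left (0::real)"] by simp
  qed (use that in \<open>simp add: \<eta>_def\<close>)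
  moreover have "\<eta> s = 0" if "s \<ge> 1" for s using h0 that by (simp add: \<eta>_def)
  moreover have "0 \<le> \<eta> s" "\<eta> s \<le> 1" for s
    using cutoff_bounds[OF assms] by (simp_all add: \<eta>_def h_def)
  ultimately show thesis by (rule that)
qed

text \<open>The tests \<open>\<theta> n\<close> equal 1 up to \<open>t\<close> and fall to 0 within
  a time 1/(n+1). Their derivatives act in the limit as minus a point mass at \<open>t\<close>,
  which continuity of \<open>M\<close> turns into the value there, and \<open>M0\<close> enters
  because they are 1 at time 0.\<close>

lemma integral_of_weak_derivative:
  fixes M F :: "real \<Rightarrow> real" and \<eta> :: "real \<Rightarrow> real"
  assumes \<eta>: "smooth \<eta>" "\<And>s. s \<le> 0 \<Longrightarrow> \<eta> s = 1" "\<And>s. s \<ge> 1 \<Longrightarrow> \<eta> s = 0"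
      "\<And>s. 0 \<le> \<eta> s" "\<And>s. \<eta> s \<le> 1"
    and M: "continuous_on {0..T} M" and F: "set_integrable lebesgue {0..T} F"
    and weak: "\<And>\<theta> r. smooth \<theta> \<Longrightarrow> 0 \<le> r \<Longrightarrow> r < T \<Longrightarrow> (\<And>s. s \<ge> r \<Longrightarrow> \<theta> s = 0) \<Longrightarrow>
      (LINT s:{0..T}|lebesgue. deriv \<theta> s * M s + \<theta> s * F s) = - (\<theta> 0 * M0)"
    and t: "t \<in> {0..T}" and T: "T > 0"
  shows "M t = M0 + (LINT s:{0..t}|lebesgue. F s)"
proof -
  have lt: "M t = M0 + (LINT s:{0..t}|lebesgue. F s)" if t: "0 \<le> t" "t < T" for t
  proof -
    let ?r = "\<lambda>n. real (Suc n)"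
    define \<theta> where "\<theta> n s = \<eta> (- ?r n * t + ?r n * s)" for n s
    have sm: "smooth (\<theta> n)" for n
      unfolding \<theta>_def by (intro smooth_compose_affine \<eta> bounded_linear_mult_right)
    note D = smooth_has_real_derivative[OF sm] and D\<eta> = smooth_has_real_derivative[OF \<eta>(1)]
    have \<theta>1: "\<theta> n s = 1" if "s \<le> t" for n s
    proof -
      have "?r n * s \<le> ?r n * t" using that by (intro mult_left_mono) auto
      then show ?thesis unfolding \<theta>_def by (intro \<eta>(2)) (simp add: algebra_simps)
    qed
    have \<theta>0: "\<theta> n s = 0" if "s \<ge> t + 1 / ?r n" for n s
    proof -
      have "?r n * (s - t) \<ge> ?r n * (1 / ?r n)" using that by (intro mult_left_mono) auto
      then show ?thesis unfolding \<theta>_def by (intro \<eta>(3)) (simp add: algebra_simps)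
    qed
    have deriv0: "deriv (\<theta> n) s = 0" if "s < t \<or> s > t + 1 / ?r n" for n s
    proof -
      define U where "U = (if s < t then {..<t} else {t + 1 / ?r n<..})"
      define c where "c = (if s < t then 1 else 0 :: real)"
      have U: "open U" "s \<in> U" using that by (auto simp: U_def)
      have "\<theta> n y = c" if "y \<in> U" for y
        using that \<theta>1[of y n] \<theta>0[of n y] by (auto simp: U_def c_def split: if_splits)
      then have "(\<theta> n has_real_derivative 0) (at s)"
        using has_field_derivative_transform_within_open[OF DERIV_const[of c] U] by simp
      then show ?thesis by (rule DERIV_imp_deriv)
    qed
    have "bounded (deriv \<eta> ` {0..1})"
      by (intro compact_imp_bounded compact_continuous_image continuous_on_subset[OF D\<eta>(2)]) auto
    then obtain C where "\<forall>y\<in>deriv \<eta> ` {0..1}. norm y \<le> C"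
      by (auto simp: bounded_iff)
    then have C: "\<bar>deriv \<eta> s\<bar> \<le> C" if "s \<in> {0..1}" for s
      using that by simp
    have C0: "C \<ge> 0" using C[of 0] by auto
    have deriv_eq: "deriv (\<theta> n) s = deriv \<eta> (- ?r n * t + ?r n * s) * ?r n" for n s
      unfolding \<theta>_def
      by (rule DERIV_imp_deriv, rule DERIV_chain2[OF D\<eta>(1)]) (auto intro!: derivative_eq_intros)
    have deriv_le: "\<bar>deriv (\<theta> n) s\<bar> \<le> C * ?r n" if "s \<in> {t..t + 1 / ?r n}" for n s
    proof -
      have "?r n * (s - t) \<le> ?r n * (1 / ?r n)" using that by (intro mult_left_mono) auto
      moreover have "0 \<le> ?r n * (s - t)" using that by (intro mult_nonneg_nonneg) auto
      ultimately have "- ?r n * t + ?r n * s \<in> {0..1}" by (simp add: algebra_simps)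
      then show ?thesis unfolding deriv_eq abs_mult by (intro mult_mono C) (use C0 in auto)
    qed
    have cont: "continuous_on {0..T} (\<lambda>s. deriv (\<theta> n) s * (M s - c))" for n c
      by (intro continuous_intros M continuous_on_subset[OF D(2)]) auto
    note int_M = absolutely_integrable_continuous_real[OF cont]
    have meas_F: "(\<lambda>s. indicator {0..T} s *\<^sub>R F s) \<in> borel_measurable lebesgue"
      using F by (auto simp: set_integrable_def)
    have meas_\<theta>: "\<theta> n \<in> borel_measurable lebesgue" for n
      by (rule measurable_completion) (simp add: borel_measurable_continuous_onI smooth_imp_continuous[OF sm])
    have \<theta>_le: "\<bar>\<theta> n s\<bar> \<le> 1" for n s using \<eta>(4,5) by (simp add: \<theta>_def)
    have int_F: "set_integrable lebesgue {0..T} (\<lambda>s. \<theta> n s * F s)" for n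
      unfolding set_integrable_def
    proof (rule Bochner_Integration.integrable_bound[OF F[unfolded set_integrable_def]])
      show "(\<lambda>s. indicator {0..T} s *\<^sub>R (\<theta> n s * F s)) \<in> borel_measurable lebesgue"
        using borel_measurable_times[OF meas_\<theta> meas_F] by (simp add: mult_ac)
      show "AE s in lebesgue. norm (indicator {0..T} s *\<^sub>R (\<theta> n s * F s)) \<le> norm (indicator {0..T} s *\<^sub>R F s)"
        using \<theta>_le mult_right_mono[OF \<theta>_le abs_ge_zero] by (auto simp: indicator_def abs_mult)
    qed
    have lim_F: "(\<lambda>n. LINT s:{0..T}|lebesgue. \<theta> n s * F s) \<longlonglongrightarrow> (LINT s:{0..t}|lebesgue. F s)"
      unfolding set_lebesgue_integral_def
    proof (rule integral_dominated_convergence[where w = "\<lambda>s. norm (indicator {0..T} s *\<^sub>R F s)"])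
      show "integrable lebesgue (\<lambda>s. norm (indicator {0..T} s *\<^sub>R F s))"
        using F by (auto simp: set_integrable_def)
      have "set_integrable lebesgue {0..t} F"
        by (rule set_integrable_subset[OF F]) (use t in auto)
      then show "(\<lambda>s. indicator {0..t} s *\<^sub>R F s) \<in> borel_measurable lebesgue"
        by (auto simp: set_integrable_def)
      show "(\<lambda>s. indicator {0..T} s *\<^sub>R (\<theta> n s * F s)) \<in> borel_measurable lebesgue" for n
        using int_F by (auto simp: set_integrable_def)
      show "AE s in lebesgue. norm (indicator {0..T} s *\<^sub>R (\<theta> n s * F s)) \<le> norm (indicator {0..T} s *\<^sub>R F s)" for n
        using \<theta>_le mult_right_mono[OF \<theta>_le abs_ge_zero] by (auto simp: indicator_def abs_mult)
      show "AE s in lebesgue. (\<lambda>n. indicator {0..T} s *\<^sub>R (\<theta> n s * F s)) \<longlonglongrightarrow> indicator {0..t} s *\<^sub>R F s"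
      proof (rule AE_I2)
        fix s
        show "(\<lambda>n. indicator {0..T} s *\<^sub>R (\<theta> n s * F s)) \<longlonglongrightarrow> indicator {0..t} s *\<^sub>R F s"
        proof (cases "s \<le> t")
          case True
          then show ?thesis using t by (simp add: \<theta>1 indicator_def)
        next
          case False
          have "(\<lambda>n. 1 / ?r n) \<longlonglongrightarrow> 0" by (rule LIMSEQ_Suc[OF lim_1_over_n])
          then have "\<forall>\<^sub>F n in sequentially. 1 / ?r n < s - t" by (rule order_tendstoD) (use False in simp)
          then have "\<forall>\<^sub>F n in sequentially. indicator {0..T} s *\<^sub>R (\<theta> n s * F s) = indicator {0..t} s *\<^sub>R F s"
            by eventually_elim (use False in \<open>simp add: \<theta>0\<close>)
          then show ?thesis by (rule tendsto_eventually)
        qed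
      qed
    qed
    \<comment> \<open>From then on the descent ends before \<open>T\<close>: the test is admissible,
      and its derivative has integral -1 over the whole interval.\<close>
    have inT: "\<forall>\<^sub>F n in sequentially. 1 / ?r n < T - t"
      using t by (intro order_tendstoD[OF LIMSEQ_Suc[OF lim_1_over_n]]) simp
    have lim_M: "(\<lambda>n. LINT s:{0..T}|lebesgue. deriv (\<theta> n) s * M s) \<longlonglongrightarrow> - M t"
    proof (rule LIMSEQ_I)
      fix e :: real assume e: "e > 0"
      \<comment> \<open>The derivative of \<open>\<theta> n\<close> has height at most
        \<open>C * ?r n\<close> on an interval of length \<open>1 / ?r n\<close>, so an oscillation
        \<open>\<delta>\<close> of \<open>M\<close> costs at most \<open>C * \<delta>\<close>. The
        added 1 covers \<open>C = 0\<close>.\<close>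
      define \<delta> where "\<delta> = e / (2 * (C + 1))"
      have \<delta>: "\<delta> > 0" "C * \<delta> < e"
        using e C0 by (simp_all add: \<delta>_def field_simps) (simp add: add_strict_increasing2 mult_left_mono)
      obtain d where d: "d > 0" "\<And>s. s \<in> {0..T} \<Longrightarrow> dist s t < d \<Longrightarrow> dist (M s) (M t) < \<delta>"
        using M t \<delta>(1) unfolding continuous_on_iff by (metis atLeastAtMost_iff less_eq_real_def)
      have "\<forall>\<^sub>F n in sequentially. 1 / ?r n < d"
        using d by (intro order_tendstoD[OF LIMSEQ_Suc[OF lim_1_over_n]]) simp
      then have "\<forall>\<^sub>F n in sequentially. norm ((LINT s:{0..T}|lebesgue. deriv (\<theta> n) s * M s) - - M t) < e"
        using inT
      proof eventually_elim
        fix n assume nd: "1 / ?r n < d" and nT: "1 / ?r n < T - t"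
        have "((deriv (\<theta> n)) has_integral (\<theta> n T - \<theta> n 0)) {0..T}"
          by (rule fundamental_theorem_of_calculus)
             (use T D(1) in \<open>auto simp flip: has_real_derivative_iff_has_vector_derivative intro: has_field_derivative_at_within\<close>)
        then have "integral {0..T} (deriv (\<theta> n)) = -1"
          using \<theta>0[of n T] \<theta>1[of 0 n] nT t by (simp add: integral_unique)
        moreover have "set_integrable lebesgue {0..T} (deriv (\<theta> n))"
          by (intro absolutely_integrable_continuous_real continuous_on_subset[OF D(2)]) auto
        ultimately have I: "(LINT s:{0..T}|lebesgue. deriv (\<theta> n) s) = -1"
          and i: "set_integrable lebesgue {0..T} (deriv (\<theta> n))"
          by (simp_all add: set_lebesgue_integral_eq_integral)
        have "(LINT s:{0..T}|lebesgue. deriv (\<theta> n) s * (M s - M t))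
            = (LINT s:{0..T}|lebesgue. deriv (\<theta> n) s * M s - deriv (\<theta> n) s * M t)"
          by (simp add: right_diff_distrib)
        also have "\<dots> = (LINT s:{0..T}|lebesgue. deriv (\<theta> n) s * M s) - (LINT s:{0..T}|lebesgue. deriv (\<theta> n) s * M t)"
          using int_M[of n 0] i by (intro set_integral_diff) auto
        also have "\<dots> = (LINT s:{0..T}|lebesgue. deriv (\<theta> n) s * M s) - - M t"
          using I by simp
        finally have "norm ((LINT s:{0..T}|lebesgue. deriv (\<theta> n) s * M s) - - M t)
            = norm (LINT s|lebesgue. indicator {0..T} s *\<^sub>R (deriv (\<theta> n) s * (M s - M t)))"
          by (simp add: set_lebesgue_integral_def)
        also have "\<dots> \<le> (LINT s|lebesgue. (C * ?r n * \<delta>) * indicator {t..t + 1 / ?r n} s)"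
        proof (rule order_trans[OF integral_norm_bound integral_mono])
          show "integrable lebesgue (\<lambda>s. norm (indicator {0..T} s *\<^sub>R (deriv (\<theta> n) s * (M s - M t))))"
            using int_M[of n "M t"] by (intro integrable_norm) (simp add: set_integrable_def)
          show "integrable lebesgue (\<lambda>s. (C * ?r n * \<delta>) * indicator {t..t + 1 / ?r n} s)"
            by simp
          fix s
          show "norm (indicator {0..T} s *\<^sub>R (deriv (\<theta> n) s * (M s - M t))) \<le> (C * ?r n * \<delta>) * indicator {t..t + 1 / ?r n} s"
          proof (cases "s \<in> {t..t + 1 / ?r n}")
            case True
            then have s: "s \<in> {0..T}" "dist s t < d" using t nT nd by (auto simp: dist_real_def)
            have "\<bar>deriv (\<theta> n) s\<bar> * \<bar>M s - M t\<bar> \<le> (C * ?r n) * \<delta>"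
              using d(2)[OF s] deriv_le[OF True] C0 by (intro mult_mono) (auto simp: dist_real_def)
            then show ?thesis using True s by (simp add: abs_mult)
          next
            case False
            then have "deriv (\<theta> n) s = 0" by (intro deriv0) auto
            then show ?thesis using False by simp
          qed
        qed
        also have "\<dots> = C * \<delta>" by simp
        also have "\<dots> < e" by (rule \<delta>(2))
        finally show "norm ((LINT s:{0..T}|lebesgue. deriv (\<theta> n) s * M s) - - M t) < e" .
      qed
      then show "\<exists>no. \<forall>n\<ge>no. norm ((LINT s:{0..T}|lebesgue. deriv (\<theta> n) s * M s) - - M t) < e"
        by (simp add: eventually_sequentially)
    qed
    have "\<forall>\<^sub>F n in sequentially. (LINT s:{0..T}|lebesgue. deriv (\<theta> n) s * M s) + (LINT s:{0..T}|lebesgue. \<theta> n s * F s) = - M0"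
      using inT
    proof eventually_elim
      fix n assume nT: "1 / ?r n < T - t"
      have "(LINT s:{0..T}|lebesgue. deriv (\<theta> n) s * M s) + (LINT s:{0..T}|lebesgue. \<theta> n s * F s)
        = (LINT s:{0..T}|lebesgue. deriv (\<theta> n) s * M s + \<theta> n s * F s)"
        using int_M[of n 0] int_F by (intro set_integral_add(2)[symmetric]) auto
      also have "\<dots> = - (\<theta> n 0 * M0)"
        by (rule weak[OF sm, of "t + 1 / ?r n"]) (use t nT \<theta>0 in auto)
      finally show "(LINT s:{0..T}|lebesgue. deriv (\<theta> n) s * M s) + (LINT s:{0..T}|lebesgue. \<theta> n s * F s) = - M0"
        using \<theta>1[of 0 n] t by simp
    qed
    then have "(\<lambda>n. (LINT s:{0..T}|lebesgue. deriv (\<theta> n) s * M s) + (LINT s:{0..T}|lebesgue. \<theta> n s * F s)) \<longlonglongrightarrow> - M0"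
      by (rule tendsto_eventually)
    then have "- M t + (LINT s:{0..t}|lebesgue. F s) = - M0"
      using LIMSEQ_unique tendsto_add[OF lim_M lim_F] by blast
    then show ?thesis by simp
  qed
  \<comment> \<open>The final time leaves no room for a descent to its right. It is reached by
    continuity: the set where \<open>g\<close> equals \<open>M0\<close> is closed and contains
    \<open>{0..<T}\<close>.\<close>
  define g where "g s = M s - integral {0..s} F" for s
  have eq: "(LINT s:{0..s}|lebesgue. F s) = integral {0..s} F" if "s \<in> {0..T}" for s
    by (rule set_lebesgue_integral_eq_integral(2)[OF set_integrable_subset[OF F]]) (use that in auto)
  have "continuous_on {0..T} g"
    unfolding g_def
    by (intro continuous_intros M indefinite_integral_continuous_1 set_lebesgue_integral_eq_integral(1)[OF F])
  then have "closed {s \<in> {0..T}. g s = M0}"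
    by (rule continuous_closed_preimage_constant) simp
  moreover have "{0..<T} \<subseteq> {s \<in> {0..T}. g s = M0}"
    using lt eq by (auto simp: g_def)
  ultimately have "closure {0..<T} \<subseteq> {s \<in> {0..T}. g s = M0}"
    by (rule closure_minimal[rotated])
  then have "g t = M0" using T t by auto
  then show ?thesis using eq[OF t] by (simp add: g_def)
qed

section \<open>Weak gradients\<close>

definition laplacian :: "('a::euclidean_space \<Rightarrow> real) \<Rightarrow> 'a \<Rightarrow> real" where
  "laplacian \<xi> x = (\<Sum>b\<in>Basis. frechet_derivative (\<lambda>y. frechet_derivative \<xi> (at y) b) (at x) b)"

lemma locally_integrable_test_function:
  fixes u :: "'a::euclidean_space \<Rightarrow> 'b::euclidean_space"
  assumes u: "locally_integrable u" and \<psi>: "test_function U \<psi>"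
  shows "integrable lebesgue (\<lambda>x. \<psi> x *\<^sub>R u x)"
proof -
  obtain K where K: "compact K" "\<And>x. x \<notin> K \<Longrightarrow> \<psi> x = 0"
    using \<psi> by (auto simp: test_function_def)
  obtain B where B: "B \<ge> 0" "\<And>x. \<bar>\<psi> x\<bar> \<le> B" by (rule test_function_bounded[OF \<psi>]) blast
  have i: "integrable lebesgue (\<lambda>x. indicator K x *\<^sub>R u x)"
    using u K(1) by (simp add: locally_integrable_def set_integrable_def)
  have [measurable]: "\<psi> \<in> borel_measurable lebesgue"
    by (rule borel_imp_lebesgue_measurable[OF test_function_borel[OF \<psi>]])
  have eq: "\<psi> x *\<^sub>R u x = \<psi> x *\<^sub>R (indicator K x *\<^sub>R u x)" for x
    using K(2)[of x] by (cases "x \<in> K") auto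
  have "integrable lebesgue (\<lambda>x. \<psi> x *\<^sub>R (indicator K x *\<^sub>R u x))"
  proof (rule Bochner_Integration.integrable_bound[OF integrable_scaleR_right[OF i, of B]])
    show "(\<lambda>x. \<psi> x *\<^sub>R (indicator K x *\<^sub>R u x)) \<in> borel_measurable lebesgue"
      by (rule borel_measurable_scaleR[OF _ borel_measurable_integrable[OF i]]) measurable
  qed (use B in \<open>auto intro!: mult_right_mono simp: indicator_def\<close>)
  then show ?thesis by (simp only: eq[symmetric])
qed

text \<open>This recovers a gradient of the density as the gradient of an approximant minus that of
  the approximation error.\<close>

lemma has_weak_gradient_diff:
  assumes "has_weak_gradient u g" and "has_weak_gradient w h"
  shows "has_weak_gradient (\<lambda>x. u x - w x) (\<lambda>x. g x - h x)"
proof -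
  have L: "locally_integrable u" "locally_integrable g" "locally_integrable w" "locally_integrable h"
    using assms by (auto simp: has_weak_gradient_def)
  have "(LINT x|lebesgue. (u x - w x) * frechet_derivative \<psi> (at x) b)
      = - (LINT x|lebesgue. ((g x - h x) \<bullet> b) * \<psi> x)"
    if \<psi>: "test_function UNIV \<psi>" "b \<in> Basis" for \<psi> b
  proof -
    note D = locally_integrable_test_function[OF _ test_function_frechet_derivative[OF \<psi>]]
    have i: "integrable lebesgue (\<lambda>x. u x * frechet_derivative \<psi> (at x) b)"
        "integrable lebesgue (\<lambda>x. w x * frechet_derivative \<psi> (at x) b)"
      using D[OF L(1)] D[OF L(3)] by (simp_all add: mult.commute)
    have j: "integrable lebesgue (\<lambda>x. (v x \<bullet> b) * \<psi> x)" if "locally_integrable v" for v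
      using integrable_inner_left[OF locally_integrable_test_function[OF that \<psi>(1)], of b]
      by (simp add: mult.commute)
    show ?thesis
      using assms \<psi> i j[OF L(2)] j[OF L(4)]
      by (simp add: left_diff_distrib inner_diff_left has_weak_gradient_def)
  qed
  moreover have "locally_integrable (\<lambda>x. u x - w x)" "locally_integrable (\<lambda>x. g x - h x)"
    using L by (auto simp: locally_integrable_def)
  ultimately show ?thesis by (simp add: has_weak_gradient_def)
qed

lemma has_weak_gradient_weak_grad: "has_weak_gradient u g \<Longrightarrow> has_weak_gradient u (weak_grad u)"
  unfolding weak_grad_def by (rule someI[where P = "has_weak_gradient u"])

lemma H1_norm_finite: "H1_norm u < \<infinity> \<Longrightarrow> \<exists>g. has_weak_gradient u g"
  by (auto simp: H1_norm_def in_H1_def split: if_splits)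

text \<open>The curve lies in \<open>H\<^sup>1\<close> at almost every time because its \<open>H\<^sup>1\<close>-valued simple approximants
  are eventually at finite \<open>H\<^sup>1\<close>-distance; finiteness of the norm integral alone would not do, as
  the norm is not known to be measurable in time.\<close>

lemma in_L2_time_H1_weak_gradient:
  assumes "in_L2_time T H1_norm \<rho>"
  shows "AE t in lebesgue_on {0..T}. has_weak_gradient (\<rho> t) (weak_grad (\<rho> t))"
proof -
  obtain s where s: "\<And>n t. t \<in> {0..T} \<Longrightarrow> H1_norm (s n t) < \<infinity>"
    and lim: "AE t in lebesgue_on {0..T}. (\<lambda>n::nat. H1_norm (\<lambda>x. s n t x - \<rho> t x)) \<longlonglongrightarrow> 0"
    using assms unfolding in_L2_time_def by blast
  have "AE t in lebesgue_on {0..T}. t \<in> {0..T}"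
    by (rule AE_I2) simp
  with lim show ?thesis
  proof eventually_elim
    fix t assume l: "(\<lambda>n. H1_norm (\<lambda>x. s n t x - \<rho> t x)) \<longlonglongrightarrow> 0" and t: "t \<in> {0..T}"
    have "\<forall>\<^sub>F n in sequentially. H1_norm (\<lambda>x. s n t x - \<rho> t x) < \<infinity>"
      by (rule order_tendstoD(2)[OF l]) simp
    then obtain n where "H1_norm (\<lambda>x. s n t x - \<rho> t x) < \<infinity>"
      using eventually_happens'[OF sequentially_bot] by blast
    then obtain g h where "has_weak_gradient (\<lambda>x. s n t x - \<rho> t x) g" "has_weak_gradient (s n t) h"
      using H1_norm_finite s[OF t] by meson
    from has_weak_gradient_diff[OF this(2,1)]
    have "has_weak_gradient (\<rho> t) (\<lambda>x. h x - g x)" by simp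
    then show "has_weak_gradient (\<rho> t) (weak_grad (\<rho> t))"
      by (rule has_weak_gradient_weak_grad)
  qed
qed

text \<open>Each partial derivative of \<open>\<xi>\<close> is itself a test function; inserting it
  in the weak gradient identity and summing over the basis puts both derivatives on
  \<open>\<xi>\<close>.\<close>

lemma weak_gradient_pairing:
  assumes g: "has_weak_gradient u g" and \<xi>: "test_function UNIV \<xi>"
  shows "integrable lebesgue (\<lambda>x. g x \<bullet> grad \<xi> x)"
    and "(LINT x|lebesgue. g x \<bullet> grad \<xi> x) = - (LINT x|lebesgue. u x * laplacian \<xi> x)"
proof -
  let ?D = "\<lambda>b x. frechet_derivative \<xi> (at x) b"
  have L: "locally_integrable u" "locally_integrable g" using g by (auto simp: has_weak_gradient_def)
  have D: "test_function UNIV (?D b)" if "b \<in> Basis" for b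
    by (rule test_function_frechet_derivative[OF \<xi> that])
  have eq: "g x \<bullet> grad \<xi> x = (\<Sum>b\<in>Basis. (g x \<bullet> b) * ?D b x)" for x
    using smooth_grad(1)[OF test_function_smooth[OF \<xi>]] by (simp add: inner_sum_right mult.commute)
  have i: "integrable lebesgue (\<lambda>x. (g x \<bullet> b) * ?D b x)" if "b \<in> Basis" for b
    using integrable_inner_left[OF locally_integrable_test_function[OF L(2) D[OF that]], of b]
    by (simp add: mult.commute)
  have j: "integrable lebesgue (\<lambda>x. u x * frechet_derivative (?D b) (at x) b)" if "b \<in> Basis" for b
    using locally_integrable_test_function[OF L(1) test_function_frechet_derivative[OF D[OF that] that]]
    by (simp add: mult.commute)
  show "integrable lebesgue (\<lambda>x. g x \<bullet> grad \<xi> x)"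
    unfolding eq by (intro Bochner_Integration.integrable_sum i)
  have "(LINT x|lebesgue. g x \<bullet> grad \<xi> x) = (\<Sum>b\<in>Basis. LINT x|lebesgue. (g x \<bullet> b) * ?D b x)"
    unfolding eq by (intro Bochner_Integration.integral_sum i)
  also have "\<dots> = (\<Sum>b\<in>Basis. - (LINT x|lebesgue. u x * frechet_derivative (?D b) (at x) b))"
    using g D by (intro sum.cong refl) (simp add: has_weak_gradient_def)
  also have "\<dots> = - (LINT x|lebesgue. u x * laplacian \<xi> x)"
    unfolding laplacian_def sum_distrib_left
    by (subst Bochner_Integration.integral_sum) (simp_all add: j sum_negf)
  finally show "(LINT x|lebesgue. g x \<bullet> grad \<xi> x) = - (LINT x|lebesgue. u x * laplacian \<xi> x)" .
qed

section \<open>The local balance\<close>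

text \<open>The rate of change of the localized mass. No gradient of \<open>f\<close> remains after
  the integration by parts, which also accounts for the plus sign before
  \<open>\<nu>\<close>.\<close>

definition balance_rate ::
    "real \<Rightarrow> real \<Rightarrow> real \<Rightarrow> ('a::euclidean_space \<Rightarrow> real) \<Rightarrow> ('a \<Rightarrow> real) \<Rightarrow> real" where
  "balance_rate \<nu> \<sigma>\<^sub>1 \<sigma>\<^sub>2 \<xi> f = \<sigma>\<^sub>1 * flux newton_kernel (grad \<xi>) f f
     + (\<sigma>\<^sub>1 + \<sigma>\<^sub>2) * (LINT x|lebesgue. (f x)\<^sup>2 * \<xi> x) + \<nu> * (LINT x|lebesgue. f x * laplacian \<xi> x)"

lemma test_function_grad:
  assumes "test_function U \<xi>"
  shows "grad \<xi> \<in> borel_measurable borel"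
    and "\<exists>G. \<forall>x. norm (grad \<xi> x) \<le> G"
    and "integrable lebesgue (\<lambda>x. (norm (grad \<xi> x))\<^sup>2)"
proof -
  let ?D = "\<lambda>b x. frechet_derivative \<xi> (at x) b"
  have eq: "grad \<xi> x = (\<Sum>b\<in>Basis. ?D b x *\<^sub>R b)" for x
    using smooth_grad(1)[OF test_function_smooth[OF assms]] .
  have D: "test_function U (?D b)" if "b \<in> Basis" for b
    by (rule test_function_frechet_derivative[OF assms that])
  have [measurable]: "?D b \<in> borel_measurable borel" if "b \<in> Basis" for b
    by (rule test_function_borel[OF D[OF that]])
  show "grad \<xi> \<in> borel_measurable borel"
    unfolding eq by measurable
  have "\<forall>b\<in>Basis. \<exists>B. \<forall>x. \<bar>?D b x\<bar> \<le> B" using test_function_bounded[OF D] by metis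
  then obtain B where B: "\<And>b x. b \<in> Basis \<Longrightarrow> \<bar>?D b x\<bar> \<le> B b" by metis
  have "norm (grad \<xi> x) \<le> (\<Sum>b\<in>Basis. B b)" for x
    unfolding eq by (rule sum_norm_le) (simp add: B)
  then show "\<exists>G. \<forall>x. norm (grad \<xi> x) \<le> G" by blast
  have "(norm (grad \<xi> x))\<^sup>2 = (\<Sum>b\<in>Basis. (?D b x)\<^sup>2)" for x
    unfolding power2_norm_eq_inner by (subst euclidean_inner) (simp add: eq inner_sum_left_Basis power2_eq_square)
  then show "integrable lebesgue (\<lambda>x. (norm (grad \<xi> x))\<^sup>2)"
    using test_function_integrable(2)[OF D] by (simp add: Bochner_Integration.integrable_sum)
qed

lemma laplacian_measurable_bounded:
  assumes "test_function U \<xi>"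
  shows "laplacian \<xi> \<in> borel_measurable borel"
    and "\<exists>G. \<forall>x. \<bar>laplacian \<xi> x\<bar> \<le> G"
    and "in_L2 (laplacian \<xi>)"
proof -
  let ?D = "\<lambda>b x. frechet_derivative (\<lambda>y. frechet_derivative \<xi> (at y) b) (at x) b"
  have D: "test_function U (?D b)" if "b \<in> Basis" for b
    by (intro test_function_frechet_derivative assms that)
  have [measurable]: "?D b \<in> borel_measurable borel" if "b \<in> Basis" for b
    by (rule test_function_borel[OF D[OF that]])
  have eq: "laplacian \<xi> = (\<lambda>x. \<Sum>b\<in>Basis. ?D b x)" by (simp add: laplacian_def fun_eq_iff)
  show "laplacian \<xi> \<in> borel_measurable borel"
    unfolding eq by measurable
  have "\<forall>b\<in>Basis. \<exists>B. \<forall>x. \<bar>?D b x\<bar> \<le> B" using test_function_bounded[OF D] by metis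
  then obtain B where B: "\<And>b x. b \<in> Basis \<Longrightarrow> \<bar>?D b x\<bar> \<le> B b" by metis
  have "\<bar>laplacian \<xi> x\<bar> \<le> (\<Sum>b\<in>Basis. B b)" for x
    unfolding eq real_norm_def[symmetric] by (rule sum_norm_le) (simp add: B)
  then show "\<exists>G. \<forall>x. \<bar>laplacian \<xi> x\<bar> \<le> G" by blast
  have "in_L2 (\<lambda>x. \<Sum>b\<in>I. ?D b x)" if "finite I" "I \<subseteq> Basis" for I
    using that
  proof (induction I rule: finite_induct)
    case (insert b I)
    then show ?case using test_function_in_L2[OF D[of b]] by (simp add: in_L2_add)
  qed (simp add: in_L2_def)
  then show "in_L2 (laplacian \<xi>)" unfolding eq by simp
qed

section \<open>From almost every time to every time\<close>

lemma AE_lebesgue_on_iff: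
  "S \<in> sets lebesgue \<Longrightarrow> (AE t in lebesgue_on S. P t) \<longleftrightarrow> (AE t in lebesgue. t \<in> S \<longrightarrow> P t)"
  by (simp add: AE_restrict_space_iff)

text \<open>A nonempty open interval is not a null set. This finds good times arbitrarily close to a
  given one.\<close>

lemma AE_lebesgue_on_interval_ex:
  fixes a b :: real
  assumes "AE t in lebesgue_on {0..T}. P t" and "a < b" "{a<..<b} \<subseteq> {0..T}"
  obtains s where "a < s" "s < b" "P s"
proof -
  have "AE t in lebesgue. t \<in> {0..T} \<longrightarrow> P t"
    using assms(1) by (simp add: AE_lebesgue_on_iff)
  then have *: "AE t in lebesgue. t \<notin> {a<..<b}" if "\<not> (\<exists>s. a < s \<and> s < b \<and> P s)"
    by eventually_elim (use assms(3) that in auto)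
  have "\<exists>s. a < s \<and> s < b \<and> P s"
  proof (rule ccontr)
    assume "\<not> (\<exists>s. a < s \<and> s < b \<and> P s)"
    from *[OF this] have "{a<..<b} \<in> null_sets lebesgue" by (simp add: completion.null_sets_iff_AE)
    then show False using assms(2) by (simp add: null_sets_def)
  qed
  then show thesis using that by blast
qed

text \<open>L2 convergence controls L1 norms only on bounded sets, hence the indicators
  \<open>w n\<close> of balls. On each ball the bound \<open>K\<close> passes from nearby good times
  to \<open>t\<close>, and Fatou's lemma lets the balls exhaust the space.\<close>

lemma integrable_at_every_time:
  fixes \<rho> :: "real \<Rightarrow> 'a::euclidean_space \<Rightarrow> real"
  assumes \<rho>: "continuous_L2 T \<rho>" and T: "T > 0"
    and K: "AE t in lebesgue_on {0..T}. integrable lebesgue (\<rho> t) \<and> L1_norm (\<rho> t) \<le> K"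
    and t: "t \<in> {0..T}"
  shows "integrable lebesgue (\<rho> t)"
proof -
  have [measurable]: "\<rho> t \<in> borel_measurable lebesgue"
    using continuous_L2_in_L2[OF \<rho> t] by (simp add: in_L2_def)
  define w :: "nat \<Rightarrow> 'a \<Rightarrow> real" where "w n = indicator (cball 0 (real n))" for n
  have w: "in_L2 (w n)" for n
  proof -
    have "integrable lebesgue (w n)"
      unfolding w_def by (rule integrable_real_indicator) (simp_all add: fmeasurableD emeasure_cball)
    moreover have "(w n x)\<^sup>2 = w n x" for x by (simp add: w_def indicator_def)
    ultimately show ?thesis by (simp add: in_L2_def borel_measurable_integrable)
  qed
  have [measurable]: "w n \<in> borel_measurable lebesgue" for n using w by (simp add: in_L2_def)
  have w01: "0 \<le> w n x" "w n x \<le> 1" for n x by (simp_all add: w_def indicator_def)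
  have le: "(LINT x|lebesgue. \<bar>\<rho> t x * w n x\<bar>) \<le> K" for n
  proof (rule field_le_epsilon)
    fix e :: real assume e: "e > 0"
    \<comment> \<open>The added 1 keeps \<open>c\<close> positive for \<open>n = 0\<close>, where
      the ball is a single point and the norm is 0.\<close>
    define c where "c = L2_norm (w n) + 1"
    have c: "c > 0" by (simp add: c_def add_nonneg_pos)
    have "((\<lambda>s. L2_norm (\<lambda>x. \<rho> s x - \<rho> t x)) \<longlongrightarrow> 0) (at t within {0..T})"
      using \<rho> t by (auto simp: continuous_L2_def)
    then have "\<forall>\<^sub>F s in at t within {0..T}. L2_norm (\<lambda>x. \<rho> s x - \<rho> t x) < e / c"
      by (rule order_tendstoD) (use e c in simp)
    then obtain d where d: "d > 0" "\<And>s. s \<in> {0..T} \<Longrightarrow> s \<noteq> t \<Longrightarrow> dist s t < d \<Longrightarrow> L2_norm (\<lambda>x. \<rho> s x - \<rho> t x) < e / c"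
      unfolding eventually_at by blast
    \<comment> \<open>A one-sided interval next to \<open>t\<close>: to its right if there is room
      before \<open>T\<close>, otherwise to its left.\<close>
    define a where "a = (if t < T then t else max 0 (t - d))"
    define b where "b = (if t < T then min T (t + d) else T)"
    have ab: "a < b" "{a<..<b} \<subseteq> {0..T}" using T t d by (auto simp: a_def b_def)
    obtain s where s: "a < s" "s < b" and i: "integrable lebesgue (\<rho> s)" and l: "L1_norm (\<rho> s) \<le> K"
      using AE_lebesgue_on_interval_ex[OF K ab] by blast
    have s': "s \<in> {0..T}" "s \<noteq> t" "dist s t < d"
      using s ab t by (auto simp: a_def b_def dist_real_def split: if_splits)
    note L = continuous_L2_in_L2[OF \<rho> s'(1)] continuous_L2_in_L2[OF \<rho> t]
    have D: "in_L2 (\<lambda>x. \<rho> s x - \<rho> t x)" by (intro in_L2_diff L)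
    note i1 = in_L2_mult(1)[OF L(2) w[of n]] and i2 = in_L2_mult(1)[OF D w[of n]]
    have "(LINT x|lebesgue. \<bar>\<rho> t x * w n x\<bar>) \<le> (LINT x|lebesgue. \<bar>(\<rho> s x - \<rho> t x) * w n x\<bar> + \<bar>\<rho> s x\<bar>)"
    proof (rule integral_mono)
      fix x
      have "\<rho> t x * w n x = \<rho> s x * w n x - (\<rho> s x - \<rho> t x) * w n x" by (simp add: algebra_simps)
      then have "\<bar>\<rho> t x * w n x\<bar> \<le> \<bar>\<rho> s x * w n x\<bar> + \<bar>(\<rho> s x - \<rho> t x) * w n x\<bar>"
        by linarith
      also have "\<bar>\<rho> s x * w n x\<bar> \<le> \<bar>\<rho> s x\<bar>"
        using mult_left_mono[OF w01(2), of "\<bar>\<rho> s x\<bar>" n x] w01(1)[of n x] by (simp add: abs_mult)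
      finally show "\<bar>\<rho> t x * w n x\<bar> \<le> \<bar>(\<rho> s x - \<rho> t x) * w n x\<bar> + \<bar>\<rho> s x\<bar>" by simp
    qed (intro integrable_abs i1 Bochner_Integration.integrable_add i2 i)+
    also have "\<dots> = (LINT x|lebesgue. \<bar>(\<rho> s x - \<rho> t x) * w n x\<bar>) + L1_norm (\<rho> s)"
      unfolding L1_norm_def by (intro Bochner_Integration.integral_add integrable_abs i2 i)
    also have "\<dots> \<le> L2_norm (\<lambda>x. \<rho> s x - \<rho> t x) * L2_norm (w n) + K"
      by (intro add_mono l in_L2_mult(2) D w)
    also have "L2_norm (\<lambda>x. \<rho> s x - \<rho> t x) * L2_norm (w n) \<le> (e / c) * c"
      using d(2)[OF s'] by (intro mult_mono) (auto simp: c_def add_nonneg_nonneg e less_imp_le)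
    also have "(e / c) * c = e" using c by simp
    finally show "(LINT x|lebesgue. \<bar>\<rho> t x * w n x\<bar>) \<le> K + e" by simp
  qed
  have "(\<integral>\<^sup>+x. norm (\<rho> t x) \<partial>lebesgue) = (\<integral>\<^sup>+x. liminf (\<lambda>n. ennreal \<bar>\<rho> t x * w n x\<bar>) \<partial>lebesgue)"
  proof (rule nn_integral_cong)
    fix x :: 'a
    obtain m :: nat where m: "norm x \<le> real m" using real_arch_simple by blast
    have "\<forall>\<^sub>F n in sequentially. ennreal \<bar>\<rho> t x * w n x\<bar> = ennreal (norm (\<rho> t x))"
      using eventually_ge_at_top[of m] by eventually_elim (use m in \<open>simp add: w_def\<close>)
    then have "(\<lambda>n. ennreal \<bar>\<rho> t x * w n x\<bar>) \<longlonglongrightarrow> ennreal (norm (\<rho> t x))"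
      by (rule tendsto_eventually)
    then show "ennreal (norm (\<rho> t x)) = liminf (\<lambda>n. ennreal \<bar>\<rho> t x * w n x\<bar>)"
      by (intro lim_imp_Liminf[symmetric] sequentially_bot)
  qed
  also have "\<dots> \<le> liminf (\<lambda>n. \<integral>\<^sup>+x. ennreal \<bar>\<rho> t x * w n x\<bar> \<partial>lebesgue)"
    by (rule nn_integral_liminf) measurable
  also have "\<dots> \<le> ennreal K"
  proof (rule Liminf_le)
    have "(\<integral>\<^sup>+x. ennreal \<bar>\<rho> t x * w n x\<bar> \<partial>lebesgue) = ennreal (LINT x|lebesgue. \<bar>\<rho> t x * w n x\<bar>)" for n
      using in_L2_mult(1)[OF continuous_L2_in_L2[OF \<rho> t] w[of n]] by (intro nn_integral_eq_integral) auto
    then show "\<forall>\<^sub>F n in sequentially. (\<integral>\<^sup>+x. ennreal \<bar>\<rho> t x * w n x\<bar> \<partial>lebesgue) \<le> ennreal K"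
      using le by (simp add: ennreal_leI)
  qed simp
  finally have "(\<integral>\<^sup>+x. norm (\<rho> t x) \<partial>lebesgue) \<le> ennreal K" .
  then show ?thesis
    by (intro integrableI_bounded) (auto elim: order_le_less_trans)
qed

text \<open>The spatial part of the weak formulation at one fixed time, for a product test function:
  \<open>c\<close> is the value of its time factor there and \<open>d\<close> that of the
  derivative.\<close>

lemma integral_tensor_test_function:
  fixes f \<xi> :: "'a::euclidean_space \<Rightarrow> real"
  assumes dim: "DIM('a) \<ge> 2"
    and f: "integrable lebesgue f" "AE x in lebesgue. \<bar>f x\<bar> \<le> K" "L1_norm f \<le> K"
    and \<xi>: "test_function UNIV \<xi>"
    and \<nu>: "\<nu> = 0 \<or> has_weak_gradient f (weak_grad f)"
  shows "(LINT x|lebesgue. f x * (d * \<xi> x) + f x * (velocity \<sigma>\<^sub>1 f x \<bullet> (c *\<^sub>R grad \<xi> x))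
      + (\<sigma>\<^sub>1 + \<sigma>\<^sub>2) * (f x)\<^sup>2 * (c * \<xi> x) - \<nu> * (weak_grad f x \<bullet> (c *\<^sub>R grad \<xi> x)))
    = d * (LINT x|lebesgue. f x * \<xi> x) + c * balance_rate \<nu> \<sigma>\<^sub>1 \<sigma>\<^sub>2 \<xi> f"
proof -
  have m[measurable]: "f \<in> borel_measurable lebesgue" using f(1) by auto
  have L2: "in_L2 f" by (rule in_L1_Linf_imp_in_L2[OF f(1,2)])
  have m\<xi>[measurable]: "\<xi> \<in> borel_measurable lebesgue"
    by (rule borel_imp_lebesgue_measurable[OF test_function_borel[OF \<xi>]])
  obtain B where B: "B \<ge> 0" "\<And>x. \<bar>\<xi> x\<bar> \<le> B" by (rule test_function_bounded[OF \<xi>]) blast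
  obtain G where G: "\<And>x. norm (grad \<xi> x) \<le> G" using test_function_grad(2)[OF \<xi>] by blast
  have i1: "integrable lebesgue (\<lambda>x. f x * \<xi> x)"
    by (rule in_L2_mult(1)[OF L2 test_function_in_L2[OF \<xi>]])
  have i2: "integrable lebesgue (\<lambda>x. f x * (kernel_conv newton_kernel f x \<bullet> grad \<xi> x))"
    by (rule newton_flux(1)[OF dim f test_function_grad(1)[OF \<xi>] G])
  have "integrable lebesgue (\<lambda>x. (f x)\<^sup>2)" using L2 by (simp add: in_L2_def)
  then have i3': "integrable lebesgue (\<lambda>x. (f x)\<^sup>2 * B)" by simp
  have i3: "integrable lebesgue (\<lambda>x. (f x)\<^sup>2 * \<xi> x)"
    by (rule Bochner_Integration.integrable_bound[OF i3']) (use B in \<open>auto simp: abs_mult intro!: mult_left_mono\<close>)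
  \<comment> \<open>If \<open>\<nu> = 0\<close>, \<open>weak_grad f\<close> may be an arbitrary
    choice, but it is multiplied by 0; otherwise the pairing with the Laplacian applies.\<close>
  have i4: "integrable lebesgue (\<lambda>x. \<nu> * (weak_grad f x \<bullet> grad \<xi> x))"
    and I4: "(LINT x|lebesgue. \<nu> * (weak_grad f x \<bullet> grad \<xi> x)) = - (\<nu> * (LINT x|lebesgue. f x * laplacian \<xi> x))"
    using \<nu> weak_gradient_pairing[OF _ \<xi>] by auto
  have comb: "(LINT x|lebesgue. c1 * g1 x + c2 * g2 x + c3 * g3 x - c4 * g4 x)
      = c1 * integral\<^sup>L lebesgue g1 + c2 * integral\<^sup>L lebesgue g2 + c3 * integral\<^sup>L lebesgue g3 - c4 * integral\<^sup>L lebesgue g4"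
    if "integrable lebesgue g1" "integrable lebesgue g2" "integrable lebesgue g3" "integrable lebesgue g4"
    for g1 g2 g3 g4 :: "'a \<Rightarrow> real" and c1 c2 c3 c4
    using that by simp
  have "(LINT x|lebesgue. f x * (d * \<xi> x) + f x * (velocity \<sigma>\<^sub>1 f x \<bullet> (c *\<^sub>R grad \<xi> x))
      + (\<sigma>\<^sub>1 + \<sigma>\<^sub>2) * (f x)\<^sup>2 * (c * \<xi> x) - \<nu> * (weak_grad f x \<bullet> (c *\<^sub>R grad \<xi> x)))
    = (LINT x|lebesgue. d * (f x * \<xi> x) + (c * \<sigma>\<^sub>1) * (f x * (kernel_conv newton_kernel f x \<bullet> grad \<xi> x))
      + (c * (\<sigma>\<^sub>1 + \<sigma>\<^sub>2)) * ((f x)\<^sup>2 * \<xi> x) - c * (\<nu> * (weak_grad f x \<bullet> grad \<xi> x)))"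
    by (simp add: velocity_eq_kernel_conv[OF dim m] mult_ac)
  also have "\<dots> = d * (LINT x|lebesgue. f x * \<xi> x)
      + (c * \<sigma>\<^sub>1) * flux newton_kernel (grad \<xi>) f f
      + (c * (\<sigma>\<^sub>1 + \<sigma>\<^sub>2)) * (LINT x|lebesgue. (f x)\<^sup>2 * \<xi> x)
      - c * (LINT x|lebesgue. \<nu> * (weak_grad f x \<bullet> grad \<xi> x))"
    unfolding flux_def by (rule comb[OF i1 i2 i3 i4])
  also have "\<dots> = d * (LINT x|lebesgue. f x * \<xi> x) + c * balance_rate \<nu> \<sigma>\<^sub>1 \<sigma>\<^sub>2 \<xi> f"
    unfolding I4 balance_rate_def by (simp add: algebra_simps)
  finally show ?thesis .
qed

text \<open>What is known at almost every time, with one \<open>K\<close> for the L1 and the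
  supremum bounds. Gradients are asked for only when diffusion is present.\<close>

definition good_density :: "real \<Rightarrow> real \<Rightarrow> ('a::euclidean_space \<Rightarrow> real) \<Rightarrow> bool" where
  "good_density \<nu> K f \<longleftrightarrow> integrable lebesgue f \<and> (AE x in lebesgue. \<bar>f x\<bar> \<le> K) \<and> L1_norm f \<le> K \<and>
     (\<nu> = 0 \<or> has_weak_gradient f (weak_grad f))"

lemma weak_solution_good_density:
  assumes "weak_solution_GAG \<nu> \<sigma>\<^sub>1 \<sigma>\<^sub>2 T \<rho>\<^sub>0 \<rho>" and "\<nu> \<ge> 0"
  obtains K where "AE t in lebesgue. t \<in> {0..T} \<longrightarrow> good_density \<nu> K (\<rho> t)"
proof -
  obtain K where K: "AE t in lebesgue_on {0..T}.
     integrable lebesgue (\<rho> t) \<and> L1_norm (\<rho> t) \<le> K \<and> (AE x in lebesgue. \<bar>\<rho> t x\<bar> \<le> K)"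
    using assms(1) by (auto simp: weak_solution_GAG_def bounded_L1_Linf_def)
  have "AE t in lebesgue_on {0..T}. \<nu> = 0 \<or> has_weak_gradient (\<rho> t) (weak_grad (\<rho> t))"
  proof (cases "\<nu> = 0")
    case False
    then have "in_L2_time T H1_norm \<rho>"
      using assms by (simp add: weak_solution_GAG_def)
    from in_L2_time_H1_weak_gradient[OF this] show ?thesis by eventually_elim simp
  qed simp
  with K have "AE t in lebesgue_on {0..T}. good_density \<nu> K (\<rho> t)"
    by eventually_elim (simp add: good_density_def)
  then show thesis using that by (simp add: AE_lebesgue_on_iff)
qed

text \<open>All bounds depend on the density through \<open>K\<close> alone, hence hold uniformly
  over good times. For the quadratic term, the squared L2 norm is at most \<open>K\<close> times the
  L1 norm.\<close>

lemma balance_rate_bound: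
  fixes f :: "'a::euclidean_space \<Rightarrow> real"
  assumes dim: "DIM('a) \<ge> 2" and f: "good_density \<nu>' K f"
    and \<xi>: "test_function UNIV \<xi>" "\<And>x. \<bar>\<xi> x\<bar> \<le> 1" "\<And>x. norm (grad \<xi> x) \<le> G" "\<And>x. \<bar>laplacian \<xi> x\<bar> \<le> D"
  shows "\<bar>flux newton_kernel (grad \<xi>) f f\<bar> \<le> velocity_bound TYPE('a) K * G * K"
    and "\<bar>LINT x|lebesgue. (f x)\<^sup>2 * \<xi> x\<bar> \<le> K * K"
    and "\<bar>LINT x|lebesgue. f x * laplacian \<xi> x\<bar> \<le> D * K"
proof -
  have f': "integrable lebesgue f" "AE x in lebesgue. \<bar>f x\<bar> \<le> K" "L1_norm f \<le> K"
    using f by (auto simp: good_density_def)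
  note L2 = in_L1_Linf_imp_in_L2[OF f'(1,2)]
  have K: "K \<ge> 0" using f'(3) by (rule order_trans[rotated]) (simp add: L1_norm_def)
  have D: "D \<ge> 0" using abs_ge_zero \<xi>(4) by (rule order_trans)
  show "\<bar>flux newton_kernel (grad \<xi>) f f\<bar> \<le> velocity_bound TYPE('a) K * G * K"
    by (rule newton_flux(2)[OF dim f' test_function_grad(1)[OF \<xi>(1)] \<xi>(3)])
  have [measurable]: "f \<in> borel_measurable lebesgue" using f'(1) by auto
  have [measurable]: "\<xi> \<in> borel_measurable lebesgue" "laplacian \<xi> \<in> borel_measurable lebesgue"
    using \<xi>(1) by (auto intro!: borel_imp_lebesgue_measurable test_function_borel laplacian_measurable_bounded)
  have i: "integrable lebesgue (\<lambda>x. (f x)\<^sup>2)" using L2(1) by (simp add: in_L2_def)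
  have le: "(f x)\<^sup>2 * \<bar>\<xi> x\<bar> \<le> (f x)\<^sup>2" for x
    using mult_left_mono[OF \<xi>(2), of "(f x)\<^sup>2"] by simp
  have i': "integrable lebesgue (\<lambda>x. (f x)\<^sup>2 * \<xi> x)"
    by (rule Bochner_Integration.integrable_bound[OF i]) (use le in \<open>auto simp: abs_mult\<close>)
  have "\<bar>LINT x|lebesgue. (f x)\<^sup>2 * \<xi> x\<bar> \<le> (LINT x|lebesgue. \<bar>(f x)\<^sup>2 * \<xi> x\<bar>)"
    by (rule integral_abs_bound)
  also have "\<dots> \<le> (LINT x|lebesgue. (f x)\<^sup>2)"
    by (intro integral_mono integrable_abs i i') (simp add: abs_mult le)
  also have "\<dots> \<le> K * L1_norm f" using L2(2) by (simp add: L2_norm_power2)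
  also have "\<dots> \<le> K * K" using f'(3) K by (rule mult_left_mono)
  finally show "\<bar>LINT x|lebesgue. (f x)\<^sup>2 * \<xi> x\<bar> \<le> K * K" .
  have j: "integrable lebesgue (\<lambda>x. D * \<bar>f x\<bar>)" using f'(1) by simp
  have le': "\<bar>f x * laplacian \<xi> x\<bar> \<le> D * \<bar>f x\<bar>" for x
    using mult_left_mono[OF \<xi>(4), of "\<bar>f x\<bar>"] by (simp add: abs_mult mult.commute)
  have j': "integrable lebesgue (\<lambda>x. f x * laplacian \<xi> x)"
    by (rule Bochner_Integration.integrable_bound[OF j]) (use le' D in auto)
  have "\<bar>LINT x|lebesgue. f x * laplacian \<xi> x\<bar> \<le> (LINT x|lebesgue. \<bar>f x * laplacian \<xi> x\<bar>)"
    by (rule integral_abs_bound)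
  also have "\<dots> \<le> (LINT x|lebesgue. D * \<bar>f x\<bar>)"
    by (intro integral_mono integrable_abs j j' le')
  also have "\<dots> = D * L1_norm f" by (simp add: L1_norm_def)
  also have "\<dots> \<le> D * K" using f'(3) D by (rule mult_left_mono)
  finally show "\<bar>LINT x|lebesgue. f x * laplacian \<xi> x\<bar> \<le> D * K" .
qed

lemma continuous_imp_indicator_measurable:
  fixes g :: "real \<Rightarrow> real"
  assumes "continuous_on {0..T} g"
  shows "(\<lambda>t. indicator {0..T} t * g t) \<in> borel_measurable lebesgue"
  using absolutely_integrable_continuous_real[OF assms] by (auto simp: set_integrable_def)

text \<open>The quadratic and diffusive terms are continuous in time. The flux is only a limit of
  continuous functions, and only at good times; completeness of Lebesgue measure absorbs the
  others.\<close>

lemma balance_rate_measurable: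
  fixes \<rho> :: "real \<Rightarrow> 'a::euclidean_space \<Rightarrow> real"
  assumes dim: "DIM('a) \<ge> 2" and \<rho>: "continuous_L2 T \<rho>"
    and good: "AE t in lebesgue. t \<in> {0..T} \<longrightarrow> good_density \<nu> K (\<rho> t)"
    and \<xi>: "test_function UNIV \<xi>"
  shows "(\<lambda>t. indicator {0..T} t * balance_rate \<nu> \<sigma>\<^sub>1 \<sigma>\<^sub>2 \<xi> (\<rho> t)) \<in> borel_measurable lebesgue"
proof -
  let ?I = "indicator {0..T} :: real \<Rightarrow> real"
  obtain G where G: "\<And>x. norm (grad \<xi> x) \<le> G" using test_function_grad(2)[OF \<xi>] by blast
  obtain B where B: "\<And>x. \<bar>\<xi> x\<bar> \<le> B" using test_function_bounded[OF \<xi>] by blast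
  define u where "u n t = ?I t * flux (truncated_kernel n) (grad \<xi>) (\<rho> t) (\<rho> t)" for n t
  have u[measurable]: "u n \<in> borel_measurable lebesgue" for n
    unfolding u_def
    by (intro continuous_imp_indicator_measurable continuous_on_truncated_flux dim \<rho> test_function_grad[OF \<xi>])
  \<comment> \<open>\<open>lim\<close> is defined at every time, even without convergence, and
    yields a measurable function that can be compared with the flux almost everywhere.\<close>
  have "AE t in lebesgue. lim (\<lambda>n. u n t) = ?I t * flux newton_kernel (grad \<xi>) (\<rho> t) (\<rho> t)"
    using good
  proof eventually_elim
    fix t assume t: "t \<in> {0..T} \<longrightarrow> good_density \<nu> K (\<rho> t)"
    show "lim (\<lambda>n. u n t) = ?I t * flux newton_kernel (grad \<xi>) (\<rho> t) (\<rho> t)"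
    proof (cases "t \<in> {0..T}")
      case True
      then have "integrable lebesgue (\<rho> t)" "AE x in lebesgue. \<bar>\<rho> t x\<bar> \<le> K" "L1_norm (\<rho> t) \<le> K"
        using t by (auto simp: good_density_def)
      from newton_flux(3)[OF dim this test_function_grad(1)[OF \<xi>] G]
      show ?thesis unfolding u_def by (intro limI tendsto_mult_left)
    next
      case False
      then show ?thesis by (simp add: u_def limI)
    qed
  qed
  moreover have "(\<lambda>t. lim (\<lambda>n. u n t)) \<in> borel_measurable lebesgue"
    by measurable
  ultimately have 1: "(\<lambda>t. ?I t * flux newton_kernel (grad \<xi>) (\<rho> t) (\<rho> t)) \<in> borel_measurable lebesgue"
    by (rule borel_measurable_AE[rotated])
  have 2: "(\<lambda>t. ?I t * (LINT x|lebesgue. (\<rho> t x)\<^sup>2 * \<xi> x)) \<in> borel_measurable lebesgue"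
    by (intro continuous_imp_indicator_measurable continuous_on_integral_square_L2[OF \<rho> _ B]
        borel_imp_lebesgue_measurable test_function_borel[OF \<xi>])
  have 3: "(\<lambda>t. ?I t * (LINT x|lebesgue. \<rho> t x * laplacian \<xi> x)) \<in> borel_measurable lebesgue"
    by (intro continuous_imp_indicator_measurable continuous_on_integral_L2[OF \<rho>]
        laplacian_measurable_bounded(3)[OF \<xi>])
  have "(\<lambda>t. ?I t * balance_rate \<nu> \<sigma>\<^sub>1 \<sigma>\<^sub>2 \<xi> (\<rho> t)) = (\<lambda>t. \<sigma>\<^sub>1 * (?I t * flux newton_kernel (grad \<xi>) (\<rho> t) (\<rho> t))
    + (\<sigma>\<^sub>1 + \<sigma>\<^sub>2) * (?I t * (LINT x|lebesgue. (\<rho> t x)\<^sup>2 * \<xi> x)) + \<nu> * (?I t * (LINT x|lebesgue. \<rho> t x * laplacian \<xi> x)))"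
    by (simp add: balance_rate_def algebra_simps fun_eq_iff)
  also have "\<dots> \<in> borel_measurable lebesgue"
    using 1 2 3 by measurable
  finally show ?thesis .
qed

text \<open>The spatial weight \<open>\<xi>\<close> is kept general; \<open>a\<close> supplies the
  step function in time.\<close>

lemma local_balance:
  fixes \<rho> :: "real \<Rightarrow> 'a::euclidean_space \<Rightarrow> real" and a \<xi> :: "'a \<Rightarrow> real"
  assumes dim: "DIM('a) \<ge> 2" and a: "cutoff a" and \<nu>: "\<nu> \<ge> 0" and T: "T > 0"
    and sol: "weak_solution_GAG \<nu> \<sigma>\<^sub>1 \<sigma>\<^sub>2 T \<rho>\<^sub>0 \<rho>"
    and good: "AE t in lebesgue. t \<in> {0..T} \<longrightarrow> good_density \<nu> K (\<rho> t)"
    and \<xi>: "test_function UNIV \<xi>" "\<And>x. \<bar>\<xi> x\<bar> \<le> 1"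
    and t: "t \<in> {0..T}"
  shows "(LINT x|lebesgue. \<rho> t x * \<xi> x) = (LINT x|lebesgue. \<rho>\<^sub>0 x * \<xi> x)
    + (LINT s:{0..t}|lebesgue. balance_rate \<nu> \<sigma>\<^sub>1 \<sigma>\<^sub>2 \<xi> (\<rho> s))"
proof -
  let ?F = "\<lambda>s. balance_rate \<nu> \<sigma>\<^sub>1 \<sigma>\<^sub>2 \<xi> (\<rho> s)" and ?M = "\<lambda>s. LINT x|lebesgue. \<rho> s x * \<xi> x"
  have \<rho>: "continuous_L2 T \<rho>" using sol by (simp add: weak_solution_GAG_def)
  have M: "continuous_on {0..T} ?M"
    by (rule continuous_on_integral_L2[OF \<rho> test_function_in_L2[OF \<xi>(1)]])
  obtain G where G: "\<And>x. norm (grad \<xi> x) \<le> G" using test_function_grad(2)[OF \<xi>(1)] by blast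
  obtain D where D: "\<And>x. \<bar>laplacian \<xi> x\<bar> \<le> D" using laplacian_measurable_bounded(2)[OF \<xi>(1)] by blast
  define L where "L = \<bar>\<sigma>\<^sub>1\<bar> * (velocity_bound TYPE('a) K * G * K) + \<bar>\<sigma>\<^sub>1 + \<sigma>\<^sub>2\<bar> * (K * K) + \<nu> * (D * K)"
  have F_meas: "(\<lambda>s. indicator {0..T} s * ?F s) \<in> borel_measurable lebesgue"
    by (rule balance_rate_measurable[OF dim \<rho> good \<xi>(1)])
  have F: "set_integrable lebesgue {0..T} ?F"
    unfolding set_integrable_def
  proof (rule Bochner_Integration.integrable_bound[where f = "\<lambda>s. L * indicator {0..T} s"])
    show "integrable lebesgue (\<lambda>s. L * indicator {0..T} s)"
      by (intro integrable_mult_right integrable_real_indicator) (simp_all add: emeasure_lborel_Icc_eq)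
    show "(\<lambda>s. indicator {0..T} s *\<^sub>R ?F s) \<in> borel_measurable lebesgue" using F_meas by simp
    show "AE s in lebesgue. norm (indicator {0..T} s *\<^sub>R ?F s) \<le> norm (L * indicator {0..T} s)"
      using good
    proof eventually_elim
      fix s assume s: "s \<in> {0..T} \<longrightarrow> good_density \<nu> K (\<rho> s)"
      show "norm (indicator {0..T} s *\<^sub>R ?F s) \<le> norm (L * indicator {0..T} s)"
      proof (cases "s \<in> {0..T}")
        case True
        note b = balance_rate_bound[OF dim s[THEN mp, OF True] \<xi> G D]
        have "\<bar>?F s\<bar> \<le> L"
          unfolding balance_rate_def L_def
          by (intro order_trans[OF abs_triangle_ineq] add_mono)
             (use b \<nu> in \<open>simp_all add: abs_mult mult_left_mono\<close>)
        then show ?thesis using True by simp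
      qed simp
    qed
  qed
  obtain \<eta> :: "real \<Rightarrow> real" where \<eta>: "smooth \<eta>" "\<And>s. s \<le> 0 \<Longrightarrow> \<eta> s = 1" "\<And>s. s \<ge> 1 \<Longrightarrow> \<eta> s = 0"
    "\<And>s. 0 \<le> \<eta> s" "\<And>s. \<eta> s \<le> 1"
    by (rule smooth_step_exists[OF a]) blast
  show ?thesis
  proof (rule integral_of_weak_derivative[OF \<eta> M F _ t T])
    fix \<theta> :: "real \<Rightarrow> real" and r
    assume \<theta>: "smooth \<theta>" and r: "0 \<le> r" "r < T" and \<theta>0: "\<And>s. s \<ge> r \<Longrightarrow> \<theta> s = 0"
    define \<phi> where "\<phi> p = \<theta> (0 + fst p) * \<xi> (0 + snd p)" for p :: "real \<times> 'a"
    obtain S where S: "compact S" "\<And>x. x \<notin> S \<Longrightarrow> \<xi> x = 0"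
      using \<xi>(1) by (auto simp: test_function_def)
    have "spacetime_test_function T \<phi>"
      unfolding spacetime_test_function_def
    \<comment> \<open>Compact support is required only for nonnegative times, so
      \<open>\<theta>\<close> may stay nonzero before time 0, as the step functions do.\<close>
    proof (intro conjI exI[of _ "{0..r} \<times> S"] allI impI)
      show "smooth \<phi>"
        unfolding \<phi>_def
        by (intro smooth_mult smooth_compose_affine bounded_linear_fst bounded_linear_snd \<theta> test_function_smooth[OF \<xi>(1)])
      show "compact ({0..r} \<times> S)" by (intro compact_Times S compact_Icc)
      show "{0..r} \<times> S \<subseteq> {0..<T} \<times> UNIV" using r by auto
      fix s x assume "0 \<le> s" "(s, x) \<notin> {0..r} \<times> S"
      then show "\<phi> (s, x) = 0" using S(2)[of x] \<theta>0[of s] by (auto simp: \<phi>_def)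
    qed
    then have weak: "(LINT t:{0..T}|lebesgue. LINT x|lebesgue.
            \<rho> t x * deriv (\<lambda>s. \<phi> (s, x)) t
            + \<rho> t x * (velocity \<sigma>\<^sub>1 (\<rho> t) x \<bullet> grad (\<lambda>y. \<phi> (t, y)) x)
            + (\<sigma>\<^sub>1 + \<sigma>\<^sub>2) * (\<rho> t x)\<^sup>2 * \<phi> (t, x)
            - \<nu> * (weak_grad (\<rho> t) x \<bullet> grad (\<lambda>y. \<phi> (t, y)) x))
        = - (LINT x|lebesgue. \<rho>\<^sub>0 x * \<phi> (0, x))"
      using sol by (simp add: weak_solution_GAG_def)
    have d: "deriv (\<lambda>s. \<phi> (s, x)) t = deriv \<theta> t * \<xi> x" for x t
      unfolding \<phi>_def
      by (rule DERIV_imp_deriv) (auto intro!: derivative_eq_intros smooth_has_real_derivative(1)[OF \<theta>])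
    have g: "grad (\<lambda>y. \<phi> (t, y)) x = \<theta> t *\<^sub>R grad \<xi> x" for x t
    proof (rule gradI)
      have "((\<lambda>y. \<theta> t * \<xi> y) has_derivative (\<lambda>h. \<theta> t * (h \<bullet> grad \<xi> x))) (at x)"
        by (intro has_derivative_mult_right smooth_grad(2) test_function_smooth[OF \<xi>(1)])
      then show "((\<lambda>y. \<phi> (t, y)) has_derivative (\<lambda>h. h \<bullet> \<theta> t *\<^sub>R grad \<xi> x)) (at x)"
        by (simp add: \<phi>_def)
    qed
    have \<phi>: "\<phi> (t, x) = \<theta> t * \<xi> x" for t x by (simp add: \<phi>_def)
    let ?W = "\<lambda>t. LINT x|lebesgue.
            \<rho> t x * (deriv \<theta> t * \<xi> x)
            + \<rho> t x * (velocity \<sigma>\<^sub>1 (\<rho> t) x \<bullet> (\<theta> t *\<^sub>R grad \<xi> x))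
            + (\<sigma>\<^sub>1 + \<sigma>\<^sub>2) * (\<rho> t x)\<^sup>2 * (\<theta> t * \<xi> x)
            - \<nu> * (weak_grad (\<rho> t) x \<bullet> (\<theta> t *\<^sub>R grad \<xi> x))"
    let ?I = "indicator {0..T} :: real \<Rightarrow> real"
    have ae: "AE t in lebesgue. ?I t *\<^sub>R (deriv \<theta> t * ?M t + \<theta> t * ?F t) = ?I t *\<^sub>R ?W t"
      using good
    proof eventually_elim
      fix s assume s: "s \<in> {0..T} \<longrightarrow> good_density \<nu> K (\<rho> s)"
      show "?I s *\<^sub>R (deriv \<theta> s * ?M s + \<theta> s * ?F s) = ?I s *\<^sub>R ?W s"
      proof (cases "s \<in> {0..T}")
        case True
        with s have "integrable lebesgue (\<rho> s)" "AE x in lebesgue. \<bar>\<rho> s x\<bar> \<le> K" "L1_norm (\<rho> s) \<le> K"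
          and n: "\<nu> = 0 \<or> has_weak_gradient (\<rho> s) (weak_grad (\<rho> s))"
          by (auto simp: good_density_def)
        from integral_tensor_test_function[OF dim this(1-3) \<xi>(1) n]
        show ?thesis by simp
      qed simp
    qed
    have m1: "(\<lambda>s. ?I s * (deriv \<theta> s * ?M s)) \<in> borel_measurable lebesgue"
      by (intro continuous_imp_indicator_measurable continuous_on_mult M
          continuous_on_subset[OF smooth_has_real_derivative(2)[OF \<theta>]] subset_UNIV)
    have m2: "\<theta> \<in> borel_measurable lebesgue"
      by (intro borel_imp_lebesgue_measurable borel_measurable_continuous_onI smooth_imp_continuous \<theta>)
    have "(\<lambda>s. ?I s * (deriv \<theta> s * ?M s) + \<theta> s * (?I s * ?F s)) \<in> borel_measurable lebesgue"
      by (intro borel_measurable_add borel_measurable_times m1 m2 F_meas)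
    then have m: "(\<lambda>s. ?I s *\<^sub>R (deriv \<theta> s * ?M s + \<theta> s * ?F s)) \<in> borel_measurable lebesgue"
      by (simp add: algebra_simps)
    \<comment> \<open>Measurability of \<open>?W\<close> in time is inherited: by \<open>ae\<close>
      it agrees almost everywhere with a measurable function, and Lebesgue measure is
      complete.\<close>
    have "(LINT s:{0..T}|lebesgue. deriv \<theta> s * ?M s + \<theta> s * ?F s) = (LINT s:{0..T}|lebesgue. ?W s)"
      unfolding set_lebesgue_integral_def
      by (rule integral_cong_AE[OF m borel_measurable_AE[OF m ae] ae])
    also have "\<dots> = - (LINT x|lebesgue. \<rho>\<^sub>0 x * (\<theta> 0 * \<xi> x))"
      using weak unfolding d g unfolding \<phi> .
    also have "\<dots> = - (\<theta> 0 * (LINT x|lebesgue. \<rho>\<^sub>0 x * \<xi> x))"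
      by (simp only: mult.left_commute[of _ "\<theta> 0"] integral_mult_right_zero)
    finally show "(LINT s:{0..T}|lebesgue. deriv \<theta> s * ?M s + \<theta> s * ?F s)
        = - (\<theta> 0 * (LINT x|lebesgue. \<rho>\<^sub>0 x * \<xi> x))" .
  qed
qed

section \<open>Removing the cutoff\<close>

lemma frechet_derivative_scaled:
  assumes "smooth f"
  shows "frechet_derivative (\<lambda>x. f (c *\<^sub>R x)) (at x) b = c * frechet_derivative f (at (c *\<^sub>R x)) b"
proof -
  let ?D = "frechet_derivative f (at (c *\<^sub>R x))"
  have D: "(f has_derivative ?D) (at (c *\<^sub>R x))" by (rule smooth_has_derivative[OF assms])
  have "((\<lambda>x. c *\<^sub>R x) has_derivative (\<lambda>h. c *\<^sub>R h)) (at x)"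
    by (auto intro!: derivative_eq_intros)
  from has_derivative_compose[OF this D]
  have "((\<lambda>x. f (c *\<^sub>R x)) has_derivative (\<lambda>h. ?D (c *\<^sub>R h))) (at x)" .
  from frechet_derivative_at[OF this]
  show ?thesis using linear_scale[OF has_derivative_linear[OF D]] by (metis real_scaleR_def)
qed

lemma scaled_cutoff:
  fixes a :: "'a::euclidean_space \<Rightarrow> real"
  assumes a: "cutoff a" and c: "c > 0"
  shows "test_function UNIV (\<lambda>x. a (c *\<^sub>R x))"
    and "grad (\<lambda>x. a (c *\<^sub>R x)) x = c *\<^sub>R grad a (c *\<^sub>R x)"
    and "laplacian (\<lambda>x. a (c *\<^sub>R x)) x = c\<^sup>2 * laplacian a (c *\<^sub>R x)"
proof -
  note sm = cutoffD(1)[OF a]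
  have sm': "smooth (\<lambda>x. a (c *\<^sub>R x))"
    using smooth_compose_affine[OF bounded_linear_scaleR_right sm, of 0 c] by simp
  moreover have "a (c *\<^sub>R x) = 0" if "x \<notin> cball 0 (2 / c)" for x
    using that c by (intro cutoffD(2)[OF a]) (simp add: field_simps)
  ultimately show "test_function UNIV (\<lambda>x. a (c *\<^sub>R x))"
    unfolding test_function_def by (intro conjI exI[of _ "cball 0 (2 / c)"]) auto
  show "grad (\<lambda>x. a (c *\<^sub>R x)) x = c *\<^sub>R grad a (c *\<^sub>R x)"
    by (simp add: smooth_grad(1) sm sm' frechet_derivative_scaled scaleR_sum_right)
  have "frechet_derivative (\<lambda>y. frechet_derivative (\<lambda>x. a (c *\<^sub>R x)) (at y) b) (at x) b
      = c\<^sup>2 * frechet_derivative (\<lambda>y. frechet_derivative a (at y) b) (at (c *\<^sub>R x)) b" if b: "b \<in> Basis" for b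
  proof -
    note smb = smooth_frechet_derivative[OF sm b]
    have "(\<lambda>y. frechet_derivative (\<lambda>x. a (c *\<^sub>R x)) (at y) b) = (\<lambda>y. c * frechet_derivative a (at (c *\<^sub>R y)) b)"
      by (rule ext) (rule frechet_derivative_scaled[OF sm])
    moreover have "frechet_derivative (\<lambda>y. c * frechet_derivative a (at (c *\<^sub>R y)) b) (at x) b
        = c * frechet_derivative (\<lambda>y. frechet_derivative a (at (c *\<^sub>R y)) b) (at x) b"
    proof -
      have "smooth (\<lambda>y. frechet_derivative a (at (c *\<^sub>R y)) b)"
        using smooth_compose_affine[OF bounded_linear_scaleR_right smb, of 0 c] by simp
      from frechet_derivative_at[OF has_derivative_mult_right[OF smooth_has_derivative[OF this], of c x]]
      show ?thesis by (rule fun_cong[OF sym])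
    qed
    moreover note frechet_derivative_scaled[OF smb, of c x b]
    ultimately show ?thesis by (simp add: power2_eq_square)
  qed
  then show "laplacian (\<lambda>x. a (c *\<^sub>R x)) x = c\<^sup>2 * laplacian a (c *\<^sub>R x)"
    by (simp add: laplacian_def sum_distrib_left)
qed

lemma tendsto_integral_scaled_cutoff:
  fixes f a :: "'a::euclidean_space \<Rightarrow> real"
  assumes f: "integrable lebesgue f" and a: "cutoff a"
  shows "(\<lambda>n. LINT x|lebesgue. f x * a ((1 / real (Suc n)) *\<^sub>R x)) \<longlonglongrightarrow> (LINT x|lebesgue. f x)"
proof (rule integral_dominated_convergence[where w = "\<lambda>x. \<bar>f x\<bar>"])
  show m: "f \<in> borel_measurable lebesgue" using f by auto
  show "integrable lebesgue (\<lambda>x. \<bar>f x\<bar>)" using f by simp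
  show "(\<lambda>x. f x * a ((1 / real (Suc n)) *\<^sub>R x)) \<in> borel_measurable lebesgue" for n
    by (intro borel_measurable_times m borel_imp_lebesgue_measurable test_function_borel[OF scaled_cutoff(1)[OF a]]) simp
  show "AE x in lebesgue. norm (f x * a ((1 / real (Suc n)) *\<^sub>R x)) \<le> \<bar>f x\<bar>" for n
    using mult_left_mono[OF cutoff_bounds(2)[OF a]] cutoff_bounds(1)[OF a] by (fastforce simp: abs_mult)
  show "AE x in lebesgue. (\<lambda>n. f x * a ((1 / real (Suc n)) *\<^sub>R x)) \<longlonglongrightarrow> f x"
  proof (rule AE_I2)
    fix x :: 'a
    obtain m :: nat where m: "norm x < real m" using reals_Archimedean2 by blast
    have "\<forall>\<^sub>F n in sequentially. f x * a ((1 / real (Suc n)) *\<^sub>R x) = f x"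
      using eventually_ge_at_top[of m]
    proof eventually_elim
      fix n assume "m \<le> n"
      then have "norm ((1 / real (Suc n)) *\<^sub>R x) < 1" using m by simp
      then show "f x * a ((1 / real (Suc n)) *\<^sub>R x) = f x" using cutoffD(3)[OF a] by simp
    qed
    then show "(\<lambda>n. f x * a ((1 / real (Suc n)) *\<^sub>R x)) \<longlonglongrightarrow> f x"
      by (rule tendsto_eventually)
  qed
qed

text \<open>The same estimates are used twice. Keeping the powers of 1/(n+1) makes flux and
  diffusion vanish in the limit; bounding those powers by 1 gives a majorant free of
  \<open>n\<close>, for dominated convergence in time.\<close>

lemma tendsto_balance_rate:
  fixes f a :: "'a::euclidean_space \<Rightarrow> real"
  assumes dim: "DIM('a) \<ge> 2" and f: "good_density \<nu>' K f" and a: "cutoff a" and \<nu>: "\<nu> \<ge> 0"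
    and G: "\<And>x. norm (grad a x) \<le> G" and D: "\<And>x. \<bar>laplacian a x\<bar> \<le> D"
  shows "\<bar>balance_rate \<nu> \<sigma>\<^sub>1 \<sigma>\<^sub>2 (\<lambda>x. a ((1 / real (Suc n)) *\<^sub>R x)) f\<bar>
      \<le> \<bar>\<sigma>\<^sub>1\<bar> * (velocity_bound TYPE('a) K * G * K) + \<bar>\<sigma>\<^sub>1 + \<sigma>\<^sub>2\<bar> * (K * K) + \<nu> * (D * K)"
    and "(\<lambda>n. balance_rate \<nu> \<sigma>\<^sub>1 \<sigma>\<^sub>2 (\<lambda>x. a ((1 / real (Suc n)) *\<^sub>R x)) f) \<longlonglongrightarrow> (\<sigma>\<^sub>1 + \<sigma>\<^sub>2) * (L2_norm f)\<^sup>2"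
proof -
  let ?c = "\<lambda>n. 1 / real (Suc n)"
  let ?\<xi> = "\<lambda>n x. a (?c n *\<^sub>R x)"
  have f': "integrable lebesgue f" "AE x in lebesgue. \<bar>f x\<bar> \<le> K"
    using f by (auto simp: good_density_def)
  have c: "?c n > 0" "?c n \<le> 1" for n by (simp_all add: field_simps)
  have \<xi>1: "\<bar>?\<xi> n x\<bar> \<le> 1" for n x using cutoff_bounds[OF a, of "?c n *\<^sub>R x"] by simp
  have G': "norm (grad (?\<xi> n) x) \<le> ?c n * G" for n x
    unfolding scaled_cutoff(2)[OF a c(1)] norm_scaleR abs_of_pos[OF c(1)]
    by (intro mult_left_mono G less_imp_le[OF c(1)])
  have D': "\<bar>laplacian (?\<xi> n) x\<bar> \<le> (?c n)\<^sup>2 * D" for n x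
    unfolding scaled_cutoff(3)[OF a c(1)] abs_mult abs_power2
    by (intro mult_left_mono D zero_le_power2)
  note b = balance_rate_bound[OF dim f scaled_cutoff(1)[OF a c(1)] \<xi>1]
  note b' = b(1)[OF G' D'] b(3)[OF G' D']
  have GD: "G \<ge> 0" "D \<ge> 0" by (rule order_trans[OF norm_ge_zero G] order_trans[OF abs_ge_zero D])+
  have c2: "(?c n)\<^sup>2 \<le> 1" for n
    by (intro power_le_one c(2) less_imp_le[OF c(1)])
  have G1: "norm (grad (?\<xi> n) x) \<le> G" and D1: "\<bar>laplacian (?\<xi> n) x\<bar> \<le> D" for n x
    by (rule order_trans[OF G' mult_left_le_one_le[OF GD(1) less_imp_le[OF c(1)] c(2)]]
        order_trans[OF D' mult_left_le_one_le[OF GD(2) zero_le_power2 c2]])+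
  show "\<bar>balance_rate \<nu> \<sigma>\<^sub>1 \<sigma>\<^sub>2 (?\<xi> n) f\<bar>
      \<le> \<bar>\<sigma>\<^sub>1\<bar> * (velocity_bound TYPE('a) K * G * K) + \<bar>\<sigma>\<^sub>1 + \<sigma>\<^sub>2\<bar> * (K * K) + \<nu> * (D * K)"
    unfolding balance_rate_def
    by (intro order_trans[OF abs_triangle_ineq] add_mono)
       (use b[OF G1 D1] \<nu> in \<open>simp_all add: abs_mult mult_left_mono del: of_nat_Suc\<close>)
  have c0: "?c \<longlonglongrightarrow> 0" by (rule LIMSEQ_Suc[OF lim_1_over_n])
  have "(\<lambda>n. velocity_bound TYPE('a) K * (?c n * G) * K) \<longlonglongrightarrow> velocity_bound TYPE('a) K * (0 * G) * K"
    by (intro tendsto_intros c0)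
  then have *: "(\<lambda>n. velocity_bound TYPE('a) K * (?c n * G) * K) \<longlonglongrightarrow> 0" by (simp only: mult_zero_left mult_zero_right)
  have 1: "(\<lambda>n. flux newton_kernel (grad (?\<xi> n)) f f) \<longlonglongrightarrow> 0"
    by (rule Lim_null_comparison[OF always_eventually *]) (simp only: real_norm_def b'(1) simp_thms)
  have "(\<lambda>n. (?c n)\<^sup>2 * D * K) \<longlonglongrightarrow> 0\<^sup>2 * D * K"
    by (intro tendsto_intros c0)
  then have *: "(\<lambda>n. (?c n)\<^sup>2 * D * K) \<longlonglongrightarrow> 0" by (simp only: zero_power2 mult_zero_left)
  have 2: "(\<lambda>n. LINT x|lebesgue. f x * laplacian (?\<xi> n) x) \<longlonglongrightarrow> 0"
    by (rule Lim_null_comparison[OF always_eventually *]) (simp only: real_norm_def b'(2) simp_thms)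
  have "integrable lebesgue (\<lambda>x. (f x)\<^sup>2)"
    using in_L1_Linf_imp_in_L2(1)[OF f'] by (simp add: in_L2_def)
  from tendsto_integral_scaled_cutoff[OF this a]
  have 3: "(\<lambda>n. LINT x|lebesgue. (f x)\<^sup>2 * ?\<xi> n x) \<longlonglongrightarrow> (L2_norm f)\<^sup>2"
    by (simp add: L2_norm_power2)
  have "(\<lambda>n. balance_rate \<nu> \<sigma>\<^sub>1 \<sigma>\<^sub>2 (?\<xi> n) f) \<longlonglongrightarrow> \<sigma>\<^sub>1 * 0 + (\<sigma>\<^sub>1 + \<sigma>\<^sub>2) * (L2_norm f)\<^sup>2 + \<nu> * 0"
    unfolding balance_rate_def by (intro tendsto_intros 1 2 3)
  then show "(\<lambda>n. balance_rate \<nu> \<sigma>\<^sub>1 \<sigma>\<^sub>2 (?\<xi> n) f) \<longlonglongrightarrow> (\<sigma>\<^sub>1 + \<sigma>\<^sub>2) * (L2_norm f)\<^sup>2"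
    by simp
qed

theorem theorem3p3:
  fixes a \<rho>\<^sub>0 :: "'a::euclidean_space \<Rightarrow> real"
    and \<rho> :: "real \<Rightarrow> 'a \<Rightarrow> real"
    and \<nu> \<sigma>\<^sub>1 \<sigma>\<^sub>2 T C R\<^sub>0 N :: real
  assumes "DIM('a) \<ge> 2"
    and "cutoff a"
    and "\<nu> \<ge> 0" and "\<sigma>\<^sub>1 \<noteq> 0" and "T > 0"
    and "in_L1_Linf \<rho>\<^sub>0"
    and "weak_solution_GAG \<nu> \<sigma>\<^sub>1 \<sigma>\<^sub>2 T \<rho>\<^sub>0 \<rho>"
    and "C > 0" and "R\<^sub>0 > 0" and "N > real DIM('a) + 1"
    and "\<And>R. R \<ge> R\<^sub>0 \<Longrightarrow> (L2_norm (\<lambda>x. outer_cutoff a R x * \<rho>\<^sub>0 x))\<^sup>2 \<le> C * R powr (- N)"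
  shows "\<forall>t\<in>{0..T}. integrable lebesgue (\<rho> t) \<and>
           mass (\<rho> t) = mass \<rho>\<^sub>0 + (\<sigma>\<^sub>1 + \<sigma>\<^sub>2) * (LINT s:{0..t}|lebesgue. (L2_norm (\<rho> s))\<^sup>2)"
proof
  fix t assume t: "t \<in> {0..T}"
  note dim = assms(1) and a = assms(2) and \<nu> = assms(3) and T = assms(5) and sol = assms(7)
  have \<rho>: "continuous_L2 T \<rho>" using sol by (simp add: weak_solution_GAG_def)
  obtain K where good: "AE t in lebesgue. t \<in> {0..T} \<longrightarrow> good_density \<nu> K (\<rho> t)"
    by (rule weak_solution_good_density[OF sol \<nu>]) blast
  \<comment> \<open>Integrability at this very time carries content: the integral of a
    non-integrable function is 0 by convention, and removing the cutoff from the mass at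
    \<open>t\<close> relies on it.\<close>
  have "AE t in lebesgue_on {0..T}. integrable lebesgue (\<rho> t) \<and> L1_norm (\<rho> t) \<le> K"
    using good by (auto simp: AE_lebesgue_on_iff good_density_def elim: eventually_mono)
  from integrable_at_every_time[OF \<rho> T this t] have int: "integrable lebesgue (\<rho> t)" .
  let ?\<xi> = "\<lambda>n x. a ((1 / real (Suc n)) *\<^sub>R x)" and ?I = "indicator {0..t} :: real \<Rightarrow> real"
  have \<xi>: "test_function UNIV (?\<xi> n)" "\<bar>?\<xi> n x\<bar> \<le> 1" for n x
    using scaled_cutoff(1)[OF a] cutoff_bounds[OF a, of "(1 / real (Suc n)) *\<^sub>R x"] by simp_all
  have "test_function UNIV a" using scaled_cutoff(1)[OF a, of 1] by simp
  then obtain G D where G: "\<And>x. norm (grad a x) \<le> G" and D: "\<And>x. \<bar>laplacian a x\<bar> \<le> D"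
    using test_function_grad(2) laplacian_measurable_bounded(2) by metis
  define L where "L = \<bar>\<sigma>\<^sub>1\<bar> * (velocity_bound TYPE('a) K * G * K) + \<bar>\<sigma>\<^sub>1 + \<sigma>\<^sub>2\<bar> * (K * K) + \<nu> * (D * K)"
  \<comment> \<open>Measurability was shown on \<open>{0..T}\<close>; a further indicator restricts
    it to \<open>{0..t}\<close>.\<close>
  have meas_I: "(\<lambda>s. ?I s *\<^sub>R g s) \<in> borel_measurable lebesgue"
    if "(\<lambda>s. indicator {0..T} s * g s) \<in> borel_measurable lebesgue" for g :: "real \<Rightarrow> real"
  proof -
    have "(\<lambda>s. ?I s * (indicator {0..T} s * g s)) \<in> borel_measurable lebesgue"
      by (rule borel_measurable_times[OF borel_imp_lebesgue_measurable that]) measurable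
    moreover have "(\<lambda>s. ?I s * (indicator {0..T} s * g s)) = (\<lambda>s. ?I s *\<^sub>R g s)"
      using t by (auto simp: indicator_def)
    ultimately show ?thesis by simp
  qed
  have "continuous_on {0..T} (\<lambda>s. (L2_norm (\<rho> s))\<^sup>2)"
    using continuous_on_integral_square_L2[OF \<rho>, of "\<lambda>_. 1" 1] by (simp add: L2_norm_power2)
  then have L2_cont: "continuous_on {0..T} (\<lambda>s. (\<sigma>\<^sub>1 + \<sigma>\<^sub>2) * (L2_norm (\<rho> s))\<^sup>2)"
    by (rule continuous_on_mult_left)
  have "(\<lambda>n. LINT s:{0..t}|lebesgue. balance_rate \<nu> \<sigma>\<^sub>1 \<sigma>\<^sub>2 (?\<xi> n) (\<rho> s))
      \<longlonglongrightarrow> (LINT s:{0..t}|lebesgue. (\<sigma>\<^sub>1 + \<sigma>\<^sub>2) * (L2_norm (\<rho> s))\<^sup>2)"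
    unfolding set_lebesgue_integral_def
  proof (rule integral_dominated_convergence[where w = "\<lambda>s. L * ?I s"])
    show "(\<lambda>s. ?I s *\<^sub>R ((\<sigma>\<^sub>1 + \<sigma>\<^sub>2) * (L2_norm (\<rho> s))\<^sup>2)) \<in> borel_measurable lebesgue"
      by (rule meas_I[OF continuous_imp_indicator_measurable[OF L2_cont]])
    show "(\<lambda>s. ?I s *\<^sub>R balance_rate \<nu> \<sigma>\<^sub>1 \<sigma>\<^sub>2 (?\<xi> n) (\<rho> s)) \<in> borel_measurable lebesgue" for n
      by (intro meas_I balance_rate_measurable[OF dim \<rho> good \<xi>(1)])
    show "integrable lebesgue (\<lambda>s. L * ?I s)"
      by (intro integrable_mult_right integrable_real_indicator) (simp_all add: emeasure_lborel_Icc_eq)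
    show "AE s in lebesgue. norm (?I s *\<^sub>R balance_rate \<nu> \<sigma>\<^sub>1 \<sigma>\<^sub>2 (?\<xi> n) (\<rho> s)) \<le> L * ?I s" for n
      using good
    proof eventually_elim
      fix s assume s: "s \<in> {0..T} \<longrightarrow> good_density \<nu> K (\<rho> s)"
      show "norm (?I s *\<^sub>R balance_rate \<nu> \<sigma>\<^sub>1 \<sigma>\<^sub>2 (?\<xi> n) (\<rho> s)) \<le> L * ?I s"
      proof (cases "s \<in> {0..t}")
        case True
        then have "good_density \<nu> K (\<rho> s)" using s t by simp
        from tendsto_balance_rate(1)[OF dim this a \<nu> G D] True show ?thesis
          by (simp add: L_def del: of_nat_Suc)
      qed simp
    qed
    show "AE s in lebesgue. (\<lambda>n. ?I s *\<^sub>R balance_rate \<nu> \<sigma>\<^sub>1 \<sigma>\<^sub>2 (?\<xi> n) (\<rho> s))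
        \<longlonglongrightarrow> ?I s *\<^sub>R ((\<sigma>\<^sub>1 + \<sigma>\<^sub>2) * (L2_norm (\<rho> s))\<^sup>2)"
      using good
    proof eventually_elim
      fix s assume s: "s \<in> {0..T} \<longrightarrow> good_density \<nu> K (\<rho> s)"
      show "(\<lambda>n. ?I s *\<^sub>R balance_rate \<nu> \<sigma>\<^sub>1 \<sigma>\<^sub>2 (?\<xi> n) (\<rho> s)) \<longlonglongrightarrow> ?I s *\<^sub>R ((\<sigma>\<^sub>1 + \<sigma>\<^sub>2) * (L2_norm (\<rho> s))\<^sup>2)"
      proof (cases "s \<in> {0..t}")
        case True
        then have "good_density \<nu> K (\<rho> s)" using s t by simp
        from tendsto_balance_rate(2)[OF dim this a \<nu> G D]
        show ?thesis by (intro tendsto_scaleR tendsto_const)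
      qed simp
    qed
  qed
  moreover have "(\<lambda>n. LINT x|lebesgue. \<rho>\<^sub>0 x * ?\<xi> n x) \<longlonglongrightarrow> mass \<rho>\<^sub>0"
    unfolding mass_def using assms(6) a
    by (intro tendsto_integral_scaled_cutoff) (auto simp: in_L1_Linf_def)
  \<comment> \<open>The local balance is exact for each \<open>n\<close>, so the localized mass at
    \<open>t\<close> inherits its limit from the two terms on the right.\<close>
  ultimately have "(\<lambda>n. LINT x|lebesgue. \<rho> t x * ?\<xi> n x)
      \<longlonglongrightarrow> mass \<rho>\<^sub>0 + (LINT s:{0..t}|lebesgue. (\<sigma>\<^sub>1 + \<sigma>\<^sub>2) * (L2_norm (\<rho> s))\<^sup>2)"
    unfolding local_balance[OF dim a \<nu> T sol good \<xi> t] by (rule tendsto_add[rotated])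
  moreover have "(\<lambda>n. LINT x|lebesgue. \<rho> t x * ?\<xi> n x) \<longlonglongrightarrow> mass (\<rho> t)"
    unfolding mass_def by (rule tendsto_integral_scaled_cutoff[OF int a])
  ultimately have "mass (\<rho> t) = mass \<rho>\<^sub>0 + (LINT s:{0..t}|lebesgue. (\<sigma>\<^sub>1 + \<sigma>\<^sub>2) * (L2_norm (\<rho> s))\<^sup>2)"
    by (rule LIMSEQ_unique[rotated])
  with int show "integrable lebesgue (\<rho> t) \<and>
      mass (\<rho> t) = mass \<rho>\<^sub>0 + (\<sigma>\<^sub>1 + \<sigma>\<^sub>2) * (LINT s:{0..t}|lebesgue. (L2_norm (\<rho> s))\<^sup>2)"
    by simp
qed

end
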